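(* Let $\eta\in\{+,-\}^n$ be such that both signs occur at least twice in $\eta$ (equivalently, the Hasse diagram of $C_\eta$ is a cycle). Read subscripts modulo $n$, with $\eta_0=\eta_n$, and for $\pi\in S_n$ define $$\delta_j=-\eta_{n-j},\qquad \pi^{\mathrm{rev}}_j=\pi_{n+1-j}\qquad(1\le j\le n).$$ Then $$\operatorname{crec}_\eta(\pi)=\operatorname{bl}^{\circ}_{C_\delta}(\pi^{\mathrm{rev}}).$$ Under the correspondence sending position $i$ to position $n+1-i$, the canonical cyclic record (the initial record position $r$ of the scan) becomes the block root with largest label among the ascent vertices of the reflected cycle $C_\delta$, and every subsequent cyclic record becomes the root of the next block of the unique valid circular block partition of $C_\delta$ labeled by $\pi^{\mathrm{rev}}$.
   Context: Subscripts are read modulo $n$. For $\eta\in\{+,-\}^n$ with both signs occurring, $C_\eta$ is the poset on $\{x_1,\ldots,x_n\}$ that is the transitive closure of $x_i\succ x_{i+1}$ if $\eta_i=+$, and $x_i\prec x_{i+1}$ if $\eta_i=-$. Similarly $C_\delta$ is defined from $\delta$ on vertices $y_1,\ldots,y_n$. Cyclic records: let $I_+(\eta)=\{i\in[n]:\eta_i=+\}$ and let $r\in I_+(\eta)$ be the index with $\pi_r=\max\{\pi_i:i\in I_+(\eta)\}$. Position $r$ is declared a record (the canonical one) and the initial threshold is $h=\pi_r$. Inspect the positions $r-1,r-2,\ldots,r+1$ (modulo $n$) in this order. Position $i$ is a record if ($\eta_i=+$ and $\pi_i>h$) or ($\eta_i=-$ and $\pi_i<h$); at each record, $h$ is reset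 to $\pi_i$. The total number of records is $\operatorname{crec}_\eta(\pi)$. Circular block statistic (Kahane). Let $\sigma\in S_n$ label $y_j$ by $\sigma_j$. Call $y_j$ an ascent vertex of $C_\delta$ if $y_{j-1}\prec y_j$ (i.e. $\delta_{j-1}=-$) and a descent vertex if $y_{j-1}\succ y_j$ (i.e. $\delta_{j-1}=+$). A circular block partition is a partition of the vertices of the cycle into cyclic intervals of consecutive vertices (blocks). When there are at least two blocks, the root of a block is its first vertex in the forward cyclic direction (increasing index modulo $n$), and the partition is valid if: (i) within each block, every non-root ascent vertex has label smaller than the root's label, and every non-root descent vertex has label larger than the root's label; and (ii) whenever block $B'$ immediately follows block $B$ cyclically, the label of the root of $B'$ is larger than the label of the root of $B$ if the root of $B'$ is an ascent vertex, and smaller if it is a descent vertex. The partition with a single block (the whole cycle) is given as root the ascent vertex with largest label, and it is valid if condition (i) holds for it. For each $\sigma$ there is exactly one valid circular block partition; $\operatorname{bl}^{\circ}_{C_\delta}(\sigma)$ is its number of blocks. *)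

theory Defs
  imports Main "HOL-Library.Disjoint_Sets" "HOL-Combinatorics.Permutations"
begin

datatype sign = SPlus | SMinus

instantiation sign :: uminus
begin

primrec uminus_sign :: "sign \<Rightarrow> sign" where
  "- SPlus = SMinus"
| "- SMinus = SPlus"

instance ..

end

text \<open>
  A sign vector of length \<open>n\<close> is a function \<open>\<eta> :: nat \<Rightarrow> sign\<close> of which only the values on
  \<open>{1..n}\<close> matter; the vertices \<open>x\<^sub>1, \<dots>, x\<^sub>n\<close> are represented by their indices.
  \<open>cyc n k\<close> is the representative of \<open>k\<close> modulo \<open>n\<close> in \<open>{1..n}\<close>, so \<open>cyc n 0 = n\<close>.
\<close>

definition cyc :: "nat \<Rightarrow> nat \<Rightarrow> nat" where
  "cyc n k = (if k mod n = 0 then n else k mod n)"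

definition cyc_pred :: "nat \<Rightarrow> nat \<Rightarrow> nat" where
  "cyc_pred n j = cyc n (j + n - 1)"

definition both_signs :: "nat \<Rightarrow> (nat \<Rightarrow> sign) \<Rightarrow> bool" where
  "both_signs n \<eta> \<longleftrightarrow> (\<exists>i\<in>{1..n}. \<eta> i = SPlus) \<and> (\<exists>i\<in>{1..n}. \<eta> i = SMinus)"

definition both_signs_twice :: "nat \<Rightarrow> (nat \<Rightarrow> sign) \<Rightarrow> bool" where
  "both_signs_twice n \<eta> \<longleftrightarrow>
     2 \<le> card {i\<in>{1..n}. \<eta> i = SPlus} \<and> 2 \<le> card {i\<in>{1..n}. \<eta> i = SMinus}"


subsection \<open>The poset \<open>C\<^sub>\<eta>\<close> and its Hasse diagram\<close>

text \<open>The strict order of \<open>C\<^sub>\<eta>\<close> on \<open>{1..n}\<close>: \<open>(a, b) \<in> cyc_less n \<eta>\<close> means \<open>x\<^sub>a \<prec> x\<^sub>b\<close>.\<close>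

definition cyc_less :: "nat \<Rightarrow> (nat \<Rightarrow> sign) \<Rightarrow> nat rel" where
  "cyc_less n \<eta> =
     ({(cyc n (i + 1), i) | i. i \<in> {1..n} \<and> \<eta> i = SPlus} \<union>
      {(i, cyc n (i + 1)) | i. i \<in> {1..n} \<and> \<eta> i = SMinus})\<^sup>+"

definition hasse_edges :: "'a rel \<Rightarrow> 'a set set" where
  "hasse_edges R = {{a, b} | a b. (a, b) \<in> R \<and> \<not> (\<exists>c. (a, c) \<in> R \<and> (c, b) \<in> R)}"

definition is_cycle_graph :: "'a set \<Rightarrow> 'a set set \<Rightarrow> bool" where
  "is_cycle_graph V E \<longleftrightarrow>
     (\<exists>m f. 3 \<le> m \<and> bij_betw f {..<m::nat} V \<and> E = {{f i, f ((i + 1) mod m)} | i. i < m})"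


subsection \<open>Cyclic records\<close>

definition plus_positions :: "nat \<Rightarrow> (nat \<Rightarrow> sign) \<Rightarrow> nat set" where
  "plus_positions n \<eta> = {i\<in>{1..n}. \<eta> i = SPlus}"

definition canonical_record :: "nat \<Rightarrow> (nat \<Rightarrow> sign) \<Rightarrow> (nat \<Rightarrow> nat) \<Rightarrow> nat" where
  "canonical_record n \<eta> \<pi> =
     (THE r. r \<in> plus_positions n \<eta> \<and> \<pi> r = Max (\<pi> ` plus_positions n \<eta>))"

text \<open>\<open>scan_records \<eta> \<pi> h ps\<close> lists, in order, the records met when inspecting \<open>ps\<close> with
  initial threshold \<open>h\<close>.\<close>

fun scan_records :: "(nat \<Rightarrow> sign) \<Rightarrow> (nat \<Rightarrow> nat) \<Rightarrow> nat \<Rightarrow> nat list \<Rightarrow> nat list" where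
  "scan_records \<eta> \<pi> h [] = []"
| "scan_records \<eta> \<pi> h (i # ps) =
     (if (\<eta> i = SPlus \<and> \<pi> i > h) \<or> (\<eta> i = SMinus \<and> \<pi> i < h)
      then i # scan_records \<eta> \<pi> (\<pi> i) ps
      else scan_records \<eta> \<pi> h ps)"

definition cyc_records :: "nat \<Rightarrow> (nat \<Rightarrow> sign) \<Rightarrow> (nat \<Rightarrow> nat) \<Rightarrow> nat list" where
  "cyc_records n \<eta> \<pi> =
     (let r = canonical_record n \<eta> \<pi>
      in r # scan_records \<eta> \<pi> (\<pi> r) (map (\<lambda>k. cyc n (r + n - k)) [1..<n]))"

definition crec :: "nat \<Rightarrow> (nat \<Rightarrow> sign) \<Rightarrow> (nat \<Rightarrow> nat) \<Rightarrow> nat" where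
  "crec n \<eta> \<pi> = length (cyc_records n \<eta> \<pi>)"


subsection \<open>Circular block partitions\<close>

definition ascent_vertex :: "nat \<Rightarrow> (nat \<Rightarrow> sign) \<Rightarrow> nat \<Rightarrow> bool" where
  "ascent_vertex n \<delta> j \<longleftrightarrow> j \<in> {1..n} \<and> (cyc_pred n j, j) \<in> cyc_less n \<delta>"

definition descent_vertex :: "nat \<Rightarrow> (nat \<Rightarrow> sign) \<Rightarrow> nat \<Rightarrow> bool" where
  "descent_vertex n \<delta> j \<longleftrightarrow> j \<in> {1..n} \<and> (j, cyc_pred n j) \<in> cyc_less n \<delta>"

definition largest_ascent :: "nat \<Rightarrow> (nat \<Rightarrow> sign) \<Rightarrow> (nat \<Rightarrow> nat) \<Rightarrow> nat" where
  "largest_ascent n \<delta> \<sigma> =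
     (THE j. ascent_vertex n \<delta> j \<and> \<sigma> j = Max (\<sigma> ` {j. ascent_vertex n \<delta> j}))"

definition arc :: "nat \<Rightarrow> nat \<Rightarrow> nat \<Rightarrow> nat set" where
  "arc n a k = {cyc n (a + t) | t. t < k}"

definition circ_partition :: "nat \<Rightarrow> nat set set \<Rightarrow> bool" where
  "circ_partition n P \<longleftrightarrow>
     partition_on {1..n} P \<and> (\<forall>B\<in>P. \<exists>a\<in>{1..n}. \<exists>k\<in>{1..n}. B = arc n a k)"

text \<open>\<open>arc_first\<close> and \<open>arc_follows\<close> are only used for proper arcs, where the starting point and
  the length are uniquely determined; they are meaningless for the whole cycle.\<close>

definition arc_first :: "nat \<Rightarrow> nat set \<Rightarrow> nat" where
  "arc_first n B = (THE a. a \<in> {1..n} \<and> (\<exists>k\<in>{1..n}. B = arc n a k))"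

definition arc_follows :: "nat \<Rightarrow> nat set \<Rightarrow> nat set \<Rightarrow> bool" where
  "arc_follows n B B' \<longleftrightarrow>
     (\<exists>a\<in>{1..n}. \<exists>k\<in>{1..n}. B = arc n a k \<and> arc_first n B' = cyc n (a + k))"

definition block_root ::
  "nat \<Rightarrow> (nat \<Rightarrow> sign) \<Rightarrow> (nat \<Rightarrow> nat) \<Rightarrow> nat set set \<Rightarrow> nat set \<Rightarrow> nat" where
  "block_root n \<delta> \<sigma> P B = (if 2 \<le> card P then arc_first n B else largest_ascent n \<delta> \<sigma>)"

definition valid_circ_partition ::
  "nat \<Rightarrow> (nat \<Rightarrow> sign) \<Rightarrow> (nat \<Rightarrow> nat) \<Rightarrow> nat set set \<Rightarrow> bool" where
  "valid_circ_partition n \<delta> \<sigma> P \<longleftrightarrow>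
     circ_partition n P \<and>
     (\<forall>B\<in>P. let \<rho> = block_root n \<delta> \<sigma> P B in
        \<forall>j\<in>B - {\<rho>}. (ascent_vertex n \<delta> j \<longrightarrow> \<sigma> j < \<sigma> \<rho>) \<and>
                     (descent_vertex n \<delta> j \<longrightarrow> \<sigma> j > \<sigma> \<rho>)) \<and>
     (2 \<le> card P \<longrightarrow>
        (\<forall>B\<in>P. \<forall>B'\<in>P. arc_follows n B B' \<longrightarrow>
           (let \<rho> = block_root n \<delta> \<sigma> P B; \<rho>' = block_root n \<delta> \<sigma> P B' in
              (ascent_vertex n \<delta> \<rho>' \<longrightarrow> \<sigma> \<rho>' > \<sigma> \<rho>) \<and>
              (descent_vertex n \<delta> \<rho>' \<longrightarrow> \<sigma> \<rho>' < \<sigma> \<rho>))))"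

definition the_circ_partition ::
  "nat \<Rightarrow> (nat \<Rightarrow> sign) \<Rightarrow> (nat \<Rightarrow> nat) \<Rightarrow> nat set set" where
  "the_circ_partition n \<delta> \<sigma> = (THE P. valid_circ_partition n \<delta> \<sigma> P)"

definition circ_bl :: "nat \<Rightarrow> (nat \<Rightarrow> sign) \<Rightarrow> (nat \<Rightarrow> nat) \<Rightarrow> nat" where
  "circ_bl n \<delta> \<sigma> = card (the_circ_partition n \<delta> \<sigma>)"


subsection \<open>Reflection\<close>

definition reflect_sign :: "nat \<Rightarrow> (nat \<Rightarrow> sign) \<Rightarrow> nat \<Rightarrow> sign" where
  "reflect_sign n \<eta> j = - \<eta> (cyc n (n - j))"

text \<open>Fixing the points outside \<open>{1..n}\<close> makes the reversal again a permutation of \<open>{1..n}\<close>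
  in the sense of \<open>permutes\<close>.\<close>

definition perm_rev :: "nat \<Rightarrow> (nat \<Rightarrow> nat) \<Rightarrow> nat \<Rightarrow> nat" where
  "perm_rev n \<pi> j = (if j \<in> {1..n} then \<pi> (n + 1 - j) else j)"

end

theory Submission
  imports Defs
begin

text \<open>
  The Hasse diagram. A directed walk in the oriented cycle never turns round, so it follows a run of
  equal signs (\<open>steps_follow_run\<close>). If both signs occur twice, such a run has length at most
  \<open>n - 2\<close>, too short to join two neighbours the long way round; hence every edge of the cycle is a
  covering relation. If one sign occurs only once, the other edges form a chain that makes
  the remaining edge redundant, and fewer than \<open>n\<close> covering relations are left.

  Records and blocks. Under \<open>i \<mapsto> n + 1 - i\<close> the backward scan becomes a forward scan, and the sign
  \<open>\<eta>\<^sub>i\<close> becomes the direction of the edge into the reflected vertex: plus for ascent vertices. A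
  circular partition is determined by its set \<open>R\<close> of first vertices, and it is convenient to describe
  the whole cycle as the partition with \<open>R\<close> a singleton. For a nonroot, condition (i) says that it is
  not a record with respect to the root of its block; for a root, condition (ii) says that it is
  a record with respect to the preceding root. These are the two cases of the rule by which the scan
  decides whether to take a vertex, with the root of the current block as the source of the threshold.
  So once a valid partition has a root at the top ascent vertex, its roots are the records of the scan
  from there, which gives uniqueness (\<open>valid_iff_root_list\<close>).

  Two points remain. Every valid partition does have this root: a root which is a descent vertex lies
  below the previous root, so the largest root label sits at an ascent vertex, and the top ascent
  vertex could not be a nonroot (\<open>valid_imp_top_root\<close>). And the records do form a valid partition: the
  comparison of the last root with the first, which the scan does not make, holds because no
  threshold exceeds the initial one (\<open>record_label_le_top\<close>).
\<close>


section \<open>Arithmetic modulo \<open>n\<close>\<close>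

lemma cyc_in: "0 < n \<Longrightarrow> cyc n k \<in> {1..n}"
  by (auto simp: cyc_def Suc_le_eq less_imp_le)

lemma cyc_mod: "0 < n \<Longrightarrow> cyc n k mod n = k mod n"
  by (simp add: cyc_def)

lemma cyc_eq_iff: "0 < n \<Longrightarrow> cyc n x = cyc n y \<longleftrightarrow> x mod n = y mod n"
  by (metis cyc_def cyc_mod)

lemma cyc_id: "x \<in> {1..n} \<Longrightarrow> cyc n x = x"
  by (cases "x = n") (auto simp: cyc_def)

lemma cyc_cyc_add: "0 < n \<Longrightarrow> cyc n (cyc n x + k) = cyc n (x + k)"
  by (metis cyc_eq_iff cyc_mod mod_add_left_eq)

lemma cyc_add_diff: "0 < n \<Longrightarrow> k \<le> m \<Longrightarrow> cyc n (cyc n (a + k) + (m - k)) = cyc n (a + m)"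
  by (subst cyc_cyc_add) simp_all

lemma cyc_add_n: "0 < n \<Longrightarrow> cyc n (x + n) = cyc n x"
  by (simp add: cyc_def)

lemma cyc_add_n_id: "x \<in> {1..n} \<Longrightarrow> cyc n (x + n) = x"
  using cyc_add_n[of n x] cyc_id[of x n] by simp

lemma cyc_cancel:
  assumes "0 < n" "cyc n (x + k) = cyc n (y + k)"
  shows "cyc n x = cyc n y"
proof -
  have "(int x + int k) mod int n = (int y + int k) mod int n"
    using assms by (metis cyc_eq_iff of_nat_add of_nat_mod)
  then have "int x mod int n = int y mod int n"
    by (metis add_diff_cancel_right' mod_diff_left_eq)
  then have "x mod n = y mod n"
    by (metis of_nat_eq_iff of_nat_mod)
  then show ?thesis
    using assms by (simp add: cyc_eq_iff)
qed

lemma cyc_add_inj: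
  assumes "0 < n" "cyc n (a + s) = cyc n (a + t)" "s < n" "t < n"
  shows "s = t"
proof -
  have "cyc n (s + a) = cyc n (t + a)"
    using assms by (simp add: add.commute)
  then have "cyc n s = cyc n t"
    using assms(1) cyc_cancel by blast
  then show ?thesis
    using assms by (simp add: cyc_eq_iff)
qed

lemma cyc_add_neq: "0 < n \<Longrightarrow> 0 < t \<Longrightarrow> t < n \<Longrightarrow> cyc n (a + t) \<noteq> cyc n a"
  using cyc_add_inj[of n a t 0] by auto

lemma cyc_reach:
  assumes "a \<in> {1..n}" "x \<in> {1..n}"
  obtains t where "t < n" "x = cyc n (a + t)"
proof (cases "a \<le> x")
  case True
  then show ?thesis
    using assms that[of "x - a"] by (auto simp: cyc_id)
next
  case False
  have "cyc n (a + (x + n - a)) = cyc n (x + n)"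
    using assms by simp
  then have "cyc n (a + (x + n - a)) = x"
    using assms by (simp add: cyc_add_n cyc_id)
  then show ?thesis
    using False assms that[of "x + n - a"] by auto
qed

lemma cyc_pred_in: "0 < n \<Longrightarrow> cyc_pred n j \<in> {1..n}"
  unfolding cyc_pred_def by (rule cyc_in)

lemma cyc_pred_succ: "j \<in> {1..n} \<Longrightarrow> cyc n (cyc_pred n j + 1) = j"
  by (simp add: cyc_pred_def cyc_cyc_add cyc_add_n cyc_id del: add_Suc_right)


section \<open>The order \<open>C\<^sub>\<eta>\<close> and its covering relations\<close>

definition cyc_steps :: "nat \<Rightarrow> (nat \<Rightarrow> sign) \<Rightarrow> nat rel" where
  "cyc_steps n \<eta> =
     {(cyc n (i + 1), i) | i. i \<in> {1..n} \<and> \<eta> i = SPlus} \<union>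
     {(i, cyc n (i + 1)) | i. i \<in> {1..n} \<and> \<eta> i = SMinus}"

lemma cyc_less_trancl: "cyc_less n \<eta> = (cyc_steps n \<eta>)\<^sup>+"
  by (simp add: cyc_less_def cyc_steps_def)

lemma sign_neq_iff: "s \<noteq> SPlus \<longleftrightarrow> s = SMinus" "s \<noteq> SMinus \<longleftrightarrow> s = SPlus"
  by (cases s; simp)+

lemma sign_minus_minus [simp]: "- (- s) = (s :: sign)"
  by (cases s) auto

text \<open>Without cardinalities the hypothesis is easily carried through a reflection, and it applies
  directly to a run of equal signs that misses the single position \<open>p\<close>.\<close>

lemma both_signs_twice_iff:
  "both_signs_twice n \<eta> \<longleftrightarrow> (\<forall>p s. \<exists>i\<in>{1..n}. i \<noteq> p \<and> \<eta> i = s)"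
proof -
  have "2 \<le> card A \<longleftrightarrow> (\<forall>p. \<exists>i\<in>A. i \<noteq> p)" if "finite A" for A :: "nat set"
  proof
    assume "2 \<le> card A"
    show "\<forall>p. \<exists>i\<in>A. i \<noteq> p"
    proof (rule ccontr)
      assume "\<not> (\<forall>p. \<exists>i\<in>A. i \<noteq> p)"
      then obtain p where "A \<subseteq> {p}" by auto
      then have "card A \<le> 1"
        using card_mono[of "{p}" A] by simp
      with \<open>2 \<le> card A\<close> show False by simp
    qed
  next
    assume *: "\<forall>p. \<exists>i\<in>A. i \<noteq> p"
    then obtain a b where "a \<in> A" "b \<in> A" "a \<noteq> b" by metis
    then show "2 \<le> card A"
      using card_mono[of A "{a, b}"] that by simp
  qed
  note * = this[of "{i\<in>{1..n}. \<eta> i = s}" for s]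
  have all_sign: "(\<forall>s. Q s) \<longleftrightarrow> Q SPlus \<and> Q SMinus" for Q
    by (metis sign.exhaust)
  show ?thesis
    unfolding both_signs_twice_def
    by (subst (1 2) *) (auto simp: all_sign all_conj_distrib Bex_def conj_ac)
qed

lemma both_signs_twice_imp_pos: "both_signs_twice n \<eta> \<Longrightarrow> 0 < n"
  by (cases n) (auto simp: both_signs_twice_def)

text \<open>A directed walk along a cycle cannot turn round, since turning round would use one edge in
  both directions. So it follows a run of equal signs, forwards or backwards.\<close>

lemma steps_follow_run:
  assumes "0 < n" "(a, b) \<in> cyc_steps n \<eta> ^^ m" "0 < m"
  shows "b = cyc n (a + m) \<and> (\<forall>t<m. \<eta> (cyc n (a + t)) = SMinus) \<or>
         a = cyc n (b + m) \<and> (\<forall>t<m. \<eta> (cyc n (b + t)) = SPlus)"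
  using assms(3,2)
proof (induction m arbitrary: b rule: nat_induct_non_zero)
  case 1
  then show ?case by (auto simp: cyc_steps_def cyc_id)
next
  case (Suc m c)
  from Suc.prems obtain b where ab: "(a, b) \<in> cyc_steps n \<eta> ^^ m" and "(b, c) \<in> cyc_steps n \<eta>"
    by auto
  then consider
      (up) "b \<in> {1..n}" "c = cyc n (b + 1)" "\<eta> b = SMinus"
    | (down) "c \<in> {1..n}" "b = cyc n (c + 1)" "\<eta> c = SPlus"
    by (auto simp: cyc_steps_def)
  then show ?case
  proof cases
    case up
    have "\<not> (\<forall>t<m. \<eta> (cyc n (b + t)) = SPlus)"
      using up \<open>0 < m\<close> by (force simp: cyc_id)
    with Suc.IH[OF ab] have b: "b = cyc n (a + m)" "\<forall>t<m. \<eta> (cyc n (a + t)) = SMinus"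
      by auto
    then have "c = cyc n (a + Suc m)"
      using up(2) cyc_cyc_add[OF \<open>0 < n\<close>, of "a + m" 1] by simp
    with b up show ?thesis by (auto simp: less_Suc_eq)
  next
    case down
    have "\<not> (b = cyc n (a + m) \<and> (\<forall>t<m. \<eta> (cyc n (a + t)) = SMinus))"
    proof
      assume *: "b = cyc n (a + m) \<and> (\<forall>t<m. \<eta> (cyc n (a + t)) = SMinus)"
      then have "cyc n (c + 1) = cyc n ((a + (m - 1)) + 1)"
        using down \<open>0 < m\<close> by simp
      then have "c = cyc n (a + (m - 1))"
        using cyc_cancel[OF \<open>0 < n\<close>] cyc_id[OF down(1)] by metis
      moreover have "\<eta> (cyc n (a + (m - 1))) = SMinus"
        using * diff_less[OF zero_less_one \<open>0 < m\<close>] by blast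
      ultimately show False using down(3) by simp
    qed
    with Suc.IH[OF ab] have b: "a = cyc n (b + m)" "\<forall>t<m. \<eta> (cyc n (b + t)) = SPlus"
      by auto
    have bt: "cyc n (b + t) = cyc n (c + Suc t)" for t
      using cyc_cyc_add[OF \<open>0 < n\<close>, of "c + 1" t] down(2) by simp
    have "\<eta> (cyc n (c + t)) = SPlus" if "t < Suc m" for t
      using that b(2) bt[of "t - 1"] down cyc_id[OF down(1)] by (cases t) auto
    with b(1) bt show ?thesis by metis
  qed
qed

text \<open>A run of length \<open>n - 1\<close> leaves a single position for the other sign.\<close>

lemma run_short:
  assumes "both_signs_twice n \<eta>" "\<And>t. t < m \<Longrightarrow> \<eta> (cyc n (a + t)) = s"
  shows "m + 1 < n"
proof (rule ccontr)
  assume "\<not> m + 1 < n"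
  have n: "0 < n" using assms(1) by (rule both_signs_twice_imp_pos)
  obtain i where i: "i \<in> {1..n}" "i \<noteq> cyc n (a + (n - 1))" "\<eta> i = - s"
    using assms(1) unfolding both_signs_twice_iff by blast
  obtain t where t: "t < n" "i = cyc n (cyc n a + t)"
    using cyc_reach[OF cyc_in[OF n] i(1)] .
  then have "i = cyc n (a + t)"
    using n by (simp add: cyc_cyc_add)
  with i t(1) \<open>\<not> m + 1 < n\<close> have "\<eta> i = s"
    using assms(2)[of t] by (cases "t = n - 1") auto
  with i show False by (cases s) auto
qed

lemma run_less:
  assumes "0 < n" "0 < m"
  shows "(\<And>t. t < m \<Longrightarrow> \<eta> (cyc n (a + t)) = SMinus) \<Longrightarrow> (cyc n a, cyc n (a + m)) \<in> cyc_less n \<eta>"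
    and "(\<And>t. t < m \<Longrightarrow> \<eta> (cyc n (a + t)) = SPlus) \<Longrightarrow> (cyc n (a + m), cyc n a) \<in> cyc_less n \<eta>"
proof -
  have up: "(cyc n x, cyc n (x + 1)) \<in> cyc_steps n \<eta>" if "\<eta> (cyc n x) = SMinus" for x
    using that cyc_in[OF assms(1), of x] cyc_cyc_add[OF assms(1), of x 1]
    unfolding cyc_steps_def by auto
  have down: "(cyc n (x + 1), cyc n x) \<in> cyc_steps n \<eta>" if "\<eta> (cyc n x) = SPlus" for x
    using that cyc_in[OF assms(1), of x] cyc_cyc_add[OF assms(1), of x 1]
    unfolding cyc_steps_def by auto
  show "(cyc n a, cyc n (a + m)) \<in> cyc_less n \<eta>"
    if "\<And>t. t < m \<Longrightarrow> \<eta> (cyc n (a + t)) = SMinus"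
    using assms(2) that unfolding cyc_less_trancl
  proof (induction m rule: nat_induct_non_zero)
    case 1
    then show ?case using up[of a] by auto
  next
    case (Suc m)
    then show ?case
      using up[of "a + m"] trancl_into_trancl[of "cyc n a" "cyc n (a + m)"] by auto
  qed
  show "(cyc n (a + m), cyc n a) \<in> cyc_less n \<eta>"
    if "\<And>t. t < m \<Longrightarrow> \<eta> (cyc n (a + t)) = SPlus"
    using assms(2) that unfolding cyc_less_trancl
  proof (induction m rule: nat_induct_non_zero)
    case 1
    then show ?case using down[of a] by auto
  next
    case (Suc m)
    then show ?case
      using down[of "a + m"] trancl_into_trancl2[of "cyc n (a + Suc m)" "cyc n (a + m)"] by auto
  qed
qed

lemma hasse_edge_step:
  assumes "e \<in> hasse_edges (cyc_less n \<eta>)"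
  obtains a b where "e = {a, b}" "(a, b) \<in> cyc_steps n \<eta>"
    "\<And>c. (a, c) \<in> cyc_less n \<eta> \<Longrightarrow> (c, b) \<in> cyc_less n \<eta> \<Longrightarrow> False"
proof -
  obtain a b where *: "e = {a, b}" "(a, b) \<in> cyc_less n \<eta>"
    "\<And>c. (a, c) \<in> cyc_less n \<eta> \<Longrightarrow> (c, b) \<in> cyc_less n \<eta> \<Longrightarrow> False"
    using assms unfolding hasse_edges_def by blast
  have "(a, b) \<in> cyc_steps n \<eta>"
    using *(2,3) unfolding cyc_less_trancl by (meson r_into_trancl tranclE)
  with * that show ?thesis by blast
qed

text \<open>An element strictly between neighbours on the cycle gives a walk of length at least two
  between them. Either way round, its length is then at least \<open>n - 1\<close>, too much for a run.\<close>

lemma cyc_step_covers: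
  assumes "both_signs_twice n \<eta>" "(a, b) \<in> cyc_steps n \<eta>"
    "(a, c) \<in> cyc_less n \<eta>" "(c, b) \<in> cyc_less n \<eta>"
  shows False
proof -
  have n: "0 < n" using assms(1) by (rule both_signs_twice_imp_pos)
  obtain k l where "0 < k" "0 < l" "(a, c) \<in> cyc_steps n \<eta> ^^ k" "(c, b) \<in> cyc_steps n \<eta> ^^ l"
    using assms(3,4) unfolding cyc_less_trancl trancl_power by blast
  then obtain m where m: "2 \<le> m" "(a, b) \<in> cyc_steps n \<eta> ^^ m"
    using relpow_add[of k l "cyc_steps n \<eta>"] by (metis Suc_leI add_mono one_add_one One_nat_def relcompI)
  have run: "False" if "cyc n (x + 1) = cyc n (x + m)" "\<forall>t<m. \<eta> (cyc n (x + t)) = s" for x s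
    using run_short[OF assms(1), of m x s] cyc_add_inj[OF n that(1)] that(2) m(1) by auto
  have round: "False" if "x \<in> {1..n}" "x = cyc n (cyc n (x + 1) + m)"
    "\<forall>t<m. \<eta> (cyc n (y + t)) = s" for x y s
  proof -
    have "m + 1 < n" using run_short[OF assms(1), of m y s] that(3) by auto
    moreover have "cyc n (x + (1 + m)) = cyc n x"
      using that(2) cyc_cyc_add[OF n, of "x + 1" m] cyc_id[OF that(1)] by (metis add.assoc)
    ultimately show False
      using cyc_add_neq[OF n, of "1 + m" x] by simp
  qed
  have disj: "b = cyc n (a + m) \<and> (\<forall>t<m. \<eta> (cyc n (a + t)) = SMinus) \<or>
      a = cyc n (b + m) \<and> (\<forall>t<m. \<eta> (cyc n (b + t)) = SPlus)"
    using steps_follow_run[OF n m(2)] m(1) by simp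
  from assms(2) consider i where "i \<in> {1..n}" "a = i" "b = cyc n (i + 1)"
    | i where "i \<in> {1..n}" "b = i" "a = cyc n (i + 1)"
    unfolding cyc_steps_def by blast
  then show False
  proof cases
    case 1
    with disj run[of i SMinus] round[of i b SPlus] show False by metis
  next
    case 2
    with disj run[of i SPlus] round[of i a SMinus] show False by metis
  qed
qed

lemma hasse_edges_cycle:
  assumes "both_signs_twice n \<eta>"
  shows "hasse_edges (cyc_less n \<eta>) = (\<lambda>i. {i, cyc n (i + 1)}) ` {1..n}"
proof (intro equalityI subsetI)
  fix e assume "e \<in> hasse_edges (cyc_less n \<eta>)"
  then show "e \<in> (\<lambda>i. {i, cyc n (i + 1)}) ` {1..n}"
    by (rule hasse_edge_step) (auto simp: cyc_steps_def)
next
  fix e assume "e \<in> (\<lambda>i. {i, cyc n (i + 1)}) ` {1..n}"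
  then obtain i where i: "i \<in> {1..n}" "e = {i, cyc n (i + 1)}" by blast
  then obtain a b where ab: "e = {a, b}" "(a, b) \<in> cyc_steps n \<eta>"
    by (cases "\<eta> i") (auto simp: cyc_steps_def insert_commute)
  then have "(a, b) \<in> cyc_less n \<eta>" by (auto simp: cyc_less_trancl)
  with ab cyc_step_covers[OF assms ab(2)] show "e \<in> hasse_edges (cyc_less n \<eta>)"
    unfolding hasse_edges_def by blast
qed

lemma cycle_graph_card_edges:
  assumes "is_cycle_graph V E" "finite V"
  shows "3 \<le> card V" "card E = card V"
proof -
  obtain m f where m: "3 \<le> m" and f: "bij_betw f {..<m::nat} V"
    and E: "E = {{f i, f ((i + 1) mod m)} | i. i < m}"
    using assms(1) unfolding is_cycle_graph_def by blast
  have V: "card V = m"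
    using bij_betw_same_card[OF f] by simp
  have inj: "f i = f j \<longleftrightarrow> i = j" if "i < m" "j < m" for i j
    using f that by (auto simp: bij_betw_def inj_on_def)
  have "inj_on (\<lambda>i. {f i, f ((i + 1) mod m)}) {..<m}"
  proof (rule inj_onI)
    fix i j assume ij: "i \<in> {..<m}" "j \<in> {..<m}"
      and eq: "{f i, f ((i + 1) mod m)} = {f j, f ((j + 1) mod m)}"
    show "i = j"
    proof (rule ccontr)
      assume "i \<noteq> j"
      with eq ij inj have "f i = f ((j + 1) mod m)" "f j = f ((i + 1) mod m)"
        by (auto simp: doubleton_eq_iff)
      with ij inj have "i = (j + 1) mod m" "j = (i + 1) mod m" by auto
      moreover have "x + 1 = m \<and> (x + 1) mod m = 0 \<or> (x + 1) mod m = x + 1" if "x < m" for x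
        using that by (cases "x + 1 = m") auto
      ultimately have "j + 1 = m \<and> i = 0 \<or> i = j + 1" "i + 1 = m \<and> j = 0 \<or> j = i + 1"
        using ij by (metis lessThan_iff)+
      then show False using m by linarith
    qed
  qed
  then have "card ((\<lambda>i. {f i, f ((i + 1) mod m)}) ` {..<m}) = m"
    by (simp add: card_image)
  moreover have "E = (\<lambda>i. {f i, f ((i + 1) mod m)}) ` {..<m}"
    using E by auto
  ultimately show "3 \<le> card V" "card E = card V"
    using V m by simp_all
qed

text \<open>If a sign occurs only at \<open>p\<close>, the other edges form a chain from one end of the edge at \<open>p\<close>
  to the other, so that edge is not a covering relation and the diagram has fewer than \<open>n\<close> edges.\<close>

lemma hasse_edges_single_sign:
  assumes "3 \<le> n" "p \<in> {1..n}" "\<And>i. i \<in> {1..n} \<Longrightarrow> i \<noteq> p \<Longrightarrow> \<eta> i \<noteq> \<eta> p"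
  shows "card (hasse_edges (cyc_less n \<eta>)) < n"
proof -
  have n: "0 < n" using assms(1) by simp
  have other: "\<eta> (cyc n (p + t)) \<noteq> \<eta> p" if "0 < t" "t < n" for t
    using assms(3)[OF cyc_in[OF n]] cyc_add_neq[OF n that, of p] cyc_id[OF assms(2)] by simp
  let ?q = "cyc n (p + 1)" and ?c = "cyc n (p + 2)"
  have shift: "cyc n (p + 1 + t) = cyc n (p + (1 + t))" "cyc n (p + 2 + t) = cyc n (p + (2 + t))" for t
    by (simp_all add: add.assoc)
  have pn: "cyc n (p + 2 + (n - 2)) = p"
  proof -
    have "p + 2 + (n - 2) = p + n" using assms(1) by simp
    then show ?thesis using cyc_add_n[OF n, of p] cyc_id[OF assms(2)] by metis
  qed
  have minus: "(p, ?c) \<in> cyc_less n \<eta> \<and> (?c, ?q) \<in> cyc_less n \<eta>" if "\<eta> p = SMinus"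
  proof -
    have pos: "\<eta> (cyc n (p + t)) = SPlus" if "0 < t" "t < n" for t
      using other[OF that] \<open>\<eta> p = SMinus\<close> by (simp add: sign_neq_iff)
    have "(cyc n (p + 2 + (n - 2)), ?c) \<in> cyc_less n \<eta>"
      using assms(1) by (intro run_less(2)) (auto simp only: shift intro!: pos)
    moreover have "(cyc n (p + 1 + 1), ?q) \<in> cyc_less n \<eta>"
      using assms(1) by (intro run_less(2)) (auto simp only: shift intro!: pos)
    ultimately show ?thesis using pn by (simp add: add.assoc)
  qed
  have plus: "(?q, ?c) \<in> cyc_less n \<eta> \<and> (?c, p) \<in> cyc_less n \<eta>" if "\<eta> p = SPlus"
  proof -
    have neg: "\<eta> (cyc n (p + t)) = SMinus" if "0 < t" "t < n" for t
      using other[OF that] \<open>\<eta> p = SPlus\<close> by (simp add: sign_neq_iff)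
    have "(?c, cyc n (p + 2 + (n - 2))) \<in> cyc_less n \<eta>"
      using assms(1) by (intro run_less(1)) (auto simp only: shift intro!: neg)
    moreover have "(?q, cyc n (p + 1 + 1)) \<in> cyc_less n \<eta>"
      using assms(1) by (intro run_less(1)) (auto simp only: shift intro!: neg)
    ultimately show ?thesis using pn by (simp add: add.assoc)
  qed
  have "hasse_edges (cyc_less n \<eta>) \<subseteq> (\<lambda>i. {i, cyc n (i + 1)}) ` ({1..n} - {p})"
  proof
    fix e assume "e \<in> hasse_edges (cyc_less n \<eta>)"
    then obtain a b where e: "e = {a, b}" "(a, b) \<in> cyc_steps n \<eta>"
      and cover: "\<And>c. (a, c) \<in> cyc_less n \<eta> \<Longrightarrow> (c, b) \<in> cyc_less n \<eta> \<Longrightarrow> False"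
      by (rule hasse_edge_step) blast
    from e(2) consider i where "i \<in> {1..n}" "a = i" "b = cyc n (i + 1)" "\<eta> i = SMinus"
      | i where "i \<in> {1..n}" "b = i" "a = cyc n (i + 1)" "\<eta> i = SPlus"
      unfolding cyc_steps_def by blast
    then obtain i where "i \<in> {1..n}" "i \<noteq> p" "e = {i, cyc n (i + 1)}"
      by cases (use e minus plus cover in \<open>blast+\<close>)
    then show "e \<in> (\<lambda>i. {i, cyc n (i + 1)}) ` ({1..n} - {p})"
      by blast
  qed
  then have "card (hasse_edges (cyc_less n \<eta>)) \<le> card ({1..n} - {p})"
    by (intro surj_card_le) auto
  also have "\<dots> < n" using assms(2) n by simp
  finally show ?thesis .
qed

lemma both_signs_twice_iff_cycle:
  assumes "both_signs n \<eta>"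
  shows "both_signs_twice n \<eta> \<longleftrightarrow> is_cycle_graph {1..n} (hasse_edges (cyc_less n \<eta>))"
proof
  assume tw: "both_signs_twice n \<eta>"
  have n: "0 < n" using tw by (rule both_signs_twice_imp_pos)
  have "card {i\<in>{1..n}. \<eta> i = SPlus} + card {i\<in>{1..n}. \<eta> i = SMinus} =
      card ({i\<in>{1..n}. \<eta> i = SPlus} \<union> {i\<in>{1..n}. \<eta> i = SMinus})"
    by (intro card_Un_disjoint[symmetric]) auto
  also have "\<dots> \<le> card {1..n}" by (intro card_mono) auto
  finally have "4 \<le> n" using tw by (simp add: both_signs_twice_def)
  moreover have "bij_betw Suc {..<n} {1..n}"
    by (simp add: bij_betw_def lessThan_atLeast0 image_Suc_atLeastLessThan atLeastLessThanSuc_atLeastAtMost)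
  moreover have "hasse_edges (cyc_less n \<eta>) = {{Suc i, Suc ((i + 1) mod n)} | i. i < n}"
  proof -
    have *: "cyc n (Suc i + 1) = Suc ((i + 1) mod n)" for i
    proof -
      have "cyc n (Suc i + 1) = cyc n (Suc ((i + 1) mod n))"
        using n by (simp add: cyc_eq_iff mod_Suc_eq)
      also have "\<dots> = Suc ((i + 1) mod n)"
        using n by (intro cyc_id) (simp add: Suc_le_eq)
      finally show ?thesis .
    qed
    have "{1..n} = Suc ` {..<n}"
      using \<open>bij_betw Suc {..<n} {1..n}\<close> by (simp add: bij_betw_def)
    then show ?thesis
      unfolding hasse_edges_cycle[OF tw] by (simp only: image_image *) auto
  qed
  ultimately show "is_cycle_graph {1..n} (hasse_edges (cyc_less n \<eta>))"
    unfolding is_cycle_graph_def by (intro exI[of _ n] exI[of _ Suc]) auto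
next
  assume cyc: "is_cycle_graph {1..n} (hasse_edges (cyc_less n \<eta>))"
  show "both_signs_twice n \<eta>"
  proof (rule ccontr)
    assume "\<not> both_signs_twice n \<eta>"
    then obtain q s where q: "\<And>i. i \<in> {1..n} \<Longrightarrow> i \<noteq> q \<Longrightarrow> \<eta> i \<noteq> s"
      unfolding both_signs_twice_iff by blast
    moreover obtain p where p: "p \<in> {1..n}" "\<eta> p = s"
      using assms unfolding both_signs_def by (cases s) auto
    ultimately have "p = q" by blast
    then have "card (hasse_edges (cyc_less n \<eta>)) < n"
      using cycle_graph_card_edges(1)[OF cyc] p q by (intro hasse_edges_single_sign[of n p]) auto
    then show False
      using cycle_graph_card_edges(2)[OF cyc] by simp
  qed
qed

text \<open>Neighbours are comparable only along their own edge: a walk the other way round would be a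
  run of length \<open>n - 1\<close>.\<close>

lemma cyc_less_neighbour_iff:
  assumes "both_signs_twice n \<delta>" "i \<in> {1..n}"
  shows "(i, cyc n (i + 1)) \<in> cyc_less n \<delta> \<longleftrightarrow> \<delta> i = SMinus"
    and "(cyc n (i + 1), i) \<in> cyc_less n \<delta> \<longleftrightarrow> \<delta> i = SPlus"
proof -
  have n: "0 < n" using assms(1) by (rule both_signs_twice_imp_pos)
  have long: "False" if "0 < k" "i = cyc n (cyc n (i + 1) + k)"
    "\<forall>t<k. \<delta> (cyc n (x + t)) = s" for k x s
  proof -
    have "k + 1 < n" using run_short[OF assms(1), of k x s] that(3) by auto
    moreover have "cyc n (i + (1 + k)) = cyc n i"
      using that(2) cyc_cyc_add[OF n, of "i + 1" k] cyc_id[OF assms(2)] by (metis add.assoc)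
    ultimately show False
      using cyc_add_neq[OF n, of "1 + k" i] by simp
  qed
  have id: "cyc n (i + 0) = i" using cyc_id[OF assms(2)] by simp
  show "(i, cyc n (i + 1)) \<in> cyc_less n \<delta> \<longleftrightarrow> \<delta> i = SMinus"
  proof
    assume "(i, cyc n (i + 1)) \<in> cyc_less n \<delta>"
    then obtain k where k: "0 < k" "(i, cyc n (i + 1)) \<in> cyc_steps n \<delta> ^^ k"
      unfolding cyc_less_trancl trancl_power by blast
    show "\<delta> i = SMinus"
      using steps_follow_run[OF n k(2,1)] long[OF k(1)] k(1) id by metis
  qed (use assms(2) in \<open>auto simp: cyc_less_trancl cyc_steps_def\<close>)
  show "(cyc n (i + 1), i) \<in> cyc_less n \<delta> \<longleftrightarrow> \<delta> i = SPlus"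
  proof
    assume "(cyc n (i + 1), i) \<in> cyc_less n \<delta>"
    then obtain k where k: "0 < k" "(cyc n (i + 1), i) \<in> cyc_steps n \<delta> ^^ k"
      unfolding cyc_less_trancl trancl_power by blast
    show "\<delta> i = SPlus"
      using steps_follow_run[OF n k(2,1)] long[OF k(1)] k(1) id by metis
  qed (use assms(2) in \<open>auto simp: cyc_less_trancl cyc_steps_def\<close>)
qed

lemma ascent_descent_vertex_iff:
  assumes "both_signs_twice n \<delta>" "j \<in> {1..n}"
  shows "ascent_vertex n \<delta> j \<longleftrightarrow> \<delta> (cyc_pred n j) = SMinus"
    and "descent_vertex n \<delta> j \<longleftrightarrow> \<delta> (cyc_pred n j) = SPlus"
  using cyc_less_neighbour_iff[OF assms(1) cyc_pred_in[OF both_signs_twice_imp_pos[OF assms(1)]], of j]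
    cyc_pred_succ[OF assms(2)] assms(2)
  unfolding ascent_vertex_def descent_vertex_def by simp_all


section \<open>Circular partitions and their sets of first vertices\<close>

text \<open>The distance from \<open>a\<close> to the next element of \<open>R\<close>. Requiring it to be positive gives \<open>n\<close> for
  \<open>R = {a}\<close>, so that the partition into a single block needs no separate treatment.\<close>

definition gap :: "nat \<Rightarrow> nat set \<Rightarrow> nat \<Rightarrow> nat" where
  "gap n R a = (LEAST k. 0 < k \<and> cyc n (a + k) \<in> R)"

definition block_at :: "nat \<Rightarrow> nat set \<Rightarrow> nat \<Rightarrow> nat set" where
  "block_at n R a = arc n a (gap n R a)"

definition blocks :: "nat \<Rightarrow> nat set \<Rightarrow> nat set set" where
  "blocks n R = block_at n R ` R"

lemma gap_props:
  assumes "0 < n" "R \<subseteq> {1..n}" "a \<in> R"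
  shows "0 < gap n R a" "gap n R a \<le> n" "cyc n (a + gap n R a) \<in> R"
    and "\<And>t. 0 < t \<Longrightarrow> t < gap n R a \<Longrightarrow> cyc n (a + t) \<notin> R"
proof -
  have "a \<in> {1..n}" using assms by auto
  then have *: "0 < n \<and> cyc n (a + n) \<in> R"
    using assms cyc_add_n cyc_id by metis
  show "0 < gap n R a" "cyc n (a + gap n R a) \<in> R"
    using LeastI[of "\<lambda>k. 0 < k \<and> cyc n (a + k) \<in> R", OF *] by (simp_all add: gap_def)
  show "gap n R a \<le> n"
    unfolding gap_def using * by (rule Least_le)
  show "cyc n (a + t) \<notin> R" if "0 < t" "t < gap n R a" for t
    using that not_less_Least unfolding gap_def by blast
qed

lemma gap_eqI:
  assumes "0 < k" "cyc n (a + k) \<in> R" "\<And>t. 0 < t \<Longrightarrow> t < k \<Longrightarrow> cyc n (a + t) \<notin> R"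
  shows "gap n R a = k"
  unfolding gap_def by (rule Least_equality) (use assms in \<open>auto simp: not_less[symmetric]\<close>)

text \<open>If two blocks met, going back from a common vertex would lead to one of the two roots first,
  inside the block of the other.\<close>

lemma block_vertex_unique:
  assumes "0 < n" "R \<subseteq> {1..n}" "a \<in> R" "b \<in> R"
    and "s < gap n R a" "t < gap n R b" "cyc n (a + s) = cyc n (b + t)"
  shows "a = b"
proof -
  have le: "a = b" if "t \<le> s" "a \<in> R" "b \<in> R" "s < gap n R a" "cyc n (a + s) = cyc n (b + t)"
    for a b s t
  proof -
    have "a + s = (a + (s - t)) + t" using that(1) by simp
    with that(5) have "cyc n (a + (s - t)) = cyc n b"
      using cyc_cancel[OF assms(1)] by metis
    moreover have "cyc n b = b" "cyc n a = a"
      using that(2,3) assms(2) by (auto intro!: cyc_id simp del: atLeastAtMost_iff)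
    ultimately show ?thesis
      using gap_props(4)[OF assms(1,2) that(2), of "s - t"] that(1,3)
        less_imp_diff_less[OF that(4), of t]
      by (cases "s = t") (simp_all del: add_diff_assoc)
  qed
  show ?thesis
    using le[of t s a b] le[of s t b a] assms by (cases "t \<le> s") auto
qed

lemma root_in_block:
  assumes "0 < n" "R \<subseteq> {1..n}" "a \<in> R"
  shows "a \<in> block_at n R a"
proof -
  have "a = cyc n (a + 0)" using assms by (auto simp: cyc_id)
  then show ?thesis
    using gap_props(1)[OF assms] unfolding block_at_def arc_def by blast
qed

lemma blocks_disjoint:
  assumes "0 < n" "R \<subseteq> {1..n}" "a \<in> R" "b \<in> R" "x \<in> block_at n R a" "x \<in> block_at n R b"
  shows "a = b"
  using assms(5,6) block_vertex_unique[OF assms(1-4)] unfolding block_at_def arc_def by auto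

lemma inj_on_block_at:
  assumes "0 < n" "R \<subseteq> {1..n}"
  shows "inj_on (block_at n R) R"
  by (rule inj_onI) (metis assms blocks_disjoint root_in_block)

lemma card_blocks: "0 < n \<Longrightarrow> R \<subseteq> {1..n} \<Longrightarrow> card (blocks n R) = card R"
  by (simp add: blocks_def card_image inj_on_block_at)

text \<open>Every vertex lies in the block of the nearest element of \<open>R\<close> behind it.\<close>

lemma blocks_cover:
  assumes "0 < n" "R \<subseteq> {1..n}" "R \<noteq> {}" "x \<in> {1..n}"
  shows "\<exists>a\<in>R. x \<in> block_at n R a"
proof -
  define D where "D u \<longleftrightarrow> (\<exists>a\<in>R. x = cyc n (a + u))" for u
  obtain b where "b \<in> R" using assms(3) by blast
  then have "\<exists>u. D u"
    using cyc_reach[of b n x] assms(2,4) unfolding D_def by blast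
  then have "D (LEAST u. D u)" by (rule LeastI_ex)
  then obtain a where a: "a \<in> R" "x = cyc n (a + (LEAST u. D u))"
    unfolding D_def by blast
  have "(LEAST u. D u) < gap n R a"
  proof (rule ccontr)
    assume "\<not> (LEAST u. D u) < gap n R a"
    then have le: "gap n R a \<le> (LEAST u. D u)" by simp
    then have "x = cyc n (cyc n (a + gap n R a) + ((LEAST u. D u) - gap n R a))"
      using a(2) cyc_add_diff[OF assms(1) le] by metis
    then have "D ((LEAST u. D u) - gap n R a)"
      using gap_props(3)[OF assms(1,2) a(1)] unfolding D_def by blast
    then have "(LEAST u. D u) \<le> (LEAST u. D u) - gap n R a" by (rule Least_le)
    with le gap_props(1)[OF assms(1,2) a(1)] show False by simp
  qed
  with a show ?thesis unfolding block_at_def arc_def by blast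
qed

lemma arc_subset: "0 < n \<Longrightarrow> arc n a k \<subseteq> {1..n}"
  unfolding arc_def using cyc_in by blast

lemma circ_partition_blocks:
  assumes "0 < n" "R \<subseteq> {1..n}" "R \<noteq> {}"
  shows "circ_partition n (blocks n R)"
proof -
  have "partition_on {1..n} (blocks n R)"
  proof (rule partition_onI)
    show "\<Union> (blocks n R) = {1..n}"
      using blocks_cover[OF assms] arc_subset[OF assms(1)] unfolding blocks_def block_at_def by blast
    show "disjnt p q" if "p \<in> blocks n R" "q \<in> blocks n R" "p \<noteq> q" for p q
      using that blocks_disjoint[OF assms(1,2)] unfolding blocks_def disjnt_def by blast
    show "{} \<notin> blocks n R"
      using root_in_block[OF assms(1,2)] unfolding blocks_def by auto
  qed
  moreover have "\<exists>a\<in>{1..n}. \<exists>k\<in>{1..n}. B = arc n a k" if B: "B \<in> blocks n R" for B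
  proof -
    obtain a where a: "a \<in> R" "B = arc n a (gap n R a)"
      using B unfolding blocks_def block_at_def by blast
    then have "a \<in> {1..n}" "gap n R a \<in> {1..n}"
      using gap_props(1,2)[OF assms(1,2) a(1)] assms(2) by auto
    with a(2) show ?thesis by blast
  qed
  ultimately show ?thesis unfolding circ_partition_def by blast
qed

lemma card_arc: "0 < n \<Longrightarrow> k \<le> n \<Longrightarrow> card (arc n a k) = k"
proof -
  assume n: "0 < n" "k \<le> n"
  have "arc n a k = (\<lambda>t. cyc n (a + t)) ` {..<k}"
    unfolding arc_def by auto
  moreover have "inj_on (\<lambda>t. cyc n (a + t)) {..<k}"
    using cyc_add_inj[OF n(1)] n(2) by (auto intro!: inj_onI)
  ultimately show ?thesis by (simp add: card_image)
qed

lemma arc_full: "0 < n \<Longrightarrow> arc n a n = {1..n}"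
  using card_arc[of n n a] arc_subset[of n a n] by (intro card_subset_eq) auto

lemma proper_arc_unique:
  assumes "k < n" "0 < k" "l \<le> n" "a \<in> {1..n}" "b \<in> {1..n}" "arc n a k = arc n b l"
  shows "a = b \<and> k = l"
proof -
  have n: "0 < n" using assms(1) by simp
  have kl: "k = l"
    using card_arc[OF n, of k a] card_arc[OF n, of l b] assms by simp
  have "b = cyc n (b + 0)" using assms(5) by (simp add: cyc_id)
  then have "b \<in> arc n a k"
    using assms(2,6) kl unfolding arc_def by blast
  then obtain s where s: "s < k" "b = cyc n (a + s)"
    unfolding arc_def by blast
  have "s = 0"
  proof (rule ccontr)
    assume "s \<noteq> 0"
    \<comment> \<open>An arc that starts later reaches past the end of the first one.\<close>
    then have "cyc n (b + (k - s)) \<in> arc n b l"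
      using kl s(1) \<open>s \<noteq> 0\<close> unfolding arc_def by (intro CollectI exI[of _ "k - s"]) auto
    moreover have "cyc n (b + (k - s)) = cyc n (a + k)"
      using s cyc_add_diff[OF n, of s k a] by simp
    ultimately obtain t where "t < k" "cyc n (a + k) = cyc n (a + t)"
      using assms(6) unfolding arc_def by auto
    then show False
      using cyc_add_inj[OF n, of a k t] assms(1) by auto
  qed
  with s kl assms(4) show ?thesis by (simp add: cyc_id)
qed

lemma arc_first_arc:
  assumes "a \<in> {1..n}" "0 < k" "k < n"
  shows "arc_first n (arc n a k) = a"
  unfolding arc_first_def
proof (rule the_equality)
  show "a \<in> {1..n} \<and> (\<exists>k'\<in>{1..n}. arc n a k = arc n a k')"
    using assms by force
  show "b = a" if "b \<in> {1..n} \<and> (\<exists>l\<in>{1..n}. arc n a k = arc n b l)" for b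
    using that proper_arc_unique[OF assms(3,2)] assms(1) by (metis atLeastAtMost_iff)
qed

lemma gap_less:
  assumes "0 < n" "R \<subseteq> {1..n}" "a \<in> R" "2 \<le> card R"
  shows "gap n R a < n"
proof -
  obtain b where b: "b \<in> R" "b \<noteq> a"
    using assms(4) card_mono[of "{a}" R] by force
  obtain t where t: "t < n" "b = cyc n (a + t)"
    using cyc_reach[of a n b] b assms(2,3) by blast
  then have "t \<noteq> 0" using b assms(2,3) cyc_id[of a n] by (metis add_0_right subsetD)
  then have "gap n R a \<le> t"
    using gap_props(4)[OF assms(1-3), of t] t b(1) by force
  with t show ?thesis by simp
qed

lemma arc_first_block_at:
  assumes "0 < n" "R \<subseteq> {1..n}" "a \<in> R" "2 \<le> card R"
  shows "arc_first n (block_at n R a) = a"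
  unfolding block_at_def
  using gap_less[OF assms] gap_props(1)[OF assms(1-3)] assms(2,3) by (intro arc_first_arc) auto

lemma arc_follows_block_at:
  assumes "0 < n" "R \<subseteq> {1..n}" "a \<in> R" "b \<in> R" "2 \<le> card R"
  shows "arc_follows n (block_at n R a) (block_at n R b) \<longleftrightarrow> b = cyc n (a + gap n R a)"
proof -
  have a: "a \<in> {1..n}" "gap n R a \<in> {1..n}"
    using gap_props(1,2)[OF assms(1-3)] assms(2,3) by auto
  have uniq: "a' = a \<and> k' = gap n R a"
    if "a' \<in> {1..n}" "k' \<in> {1..n}" "block_at n R a = arc n a' k'" for a' k'
    using proper_arc_unique[OF gap_less[OF assms(1-3,5)] gap_props(1)[OF assms(1-3)], of k' a a'] that a
    unfolding block_at_def by auto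
  have "arc_follows n (block_at n R a) (block_at n R b) \<longleftrightarrow>
      (\<exists>a'\<in>{1..n}. \<exists>k'\<in>{1..n}. block_at n R a = arc n a' k' \<and> b = cyc n (a' + k'))"
    unfolding arc_follows_def arc_first_block_at[OF assms(1,2,4,5)] ..
  also have "\<dots> \<longleftrightarrow> b = cyc n (a + gap n R a)"
    using uniq a block_at_def by metis
  finally show ?thesis .
qed

text \<open>With at least two blocks, the vertex after a block starts another block: its predecessor
  lies in a different one. So the first vertices determine the partition.\<close>

lemma circ_partition_first_vertices:
  assumes n: "0 < n" and Q: "circ_partition n Q" "2 \<le> card Q"
  shows "arc_first n ` Q \<subseteq> {1..n}" "Q = blocks n (arc_first n ` Q)"
    "card (arc_first n ` Q) = card Q"
proof -
  let ?R = "arc_first n ` Q"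
  have part: "partition_on {1..n} Q"
    using Q unfolding circ_partition_def by blast
  have same: "B = B'" if "B \<in> Q" "B' \<in> Q" "x \<in> B" "x \<in> B'" for B B' x
    using that partition_onD2[OF part] disjointD by fastforce
  have form: "\<exists>a k. a \<in> {1..n} \<and> 0 < k \<and> k < n \<and> B = arc n a k" if B: "B \<in> Q" for B
  proof -
    obtain a k where ak: "a \<in> {1..n}" "k \<in> {1..n}" "B = arc n a k"
      using Q(1) B unfolding circ_partition_def by blast
    moreover have "k \<noteq> n"
    proof
      assume "k = n"
      then have "B = {1..n}" using ak arc_full[OF n] by simp
      have "C = B" if "C \<in> Q" for C
      proof -
        obtain x where "x \<in> C"
          using \<open>C \<in> Q\<close> partition_onD3[OF part] by fastforce
        then show ?thesis
          using same[OF that B] \<open>C \<in> Q\<close> \<open>B = {1..n}\<close> partition_onD1[OF part] by blast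
      qed
      then have "Q \<subseteq> {B}" by blast
      then have "card Q \<le> 1" using card_mono[of "{B}" Q] by simp
      with Q(2) show False by simp
    qed
    ultimately show ?thesis by (intro exI[of _ a] exI[of _ k]) auto
  qed
  have first_in: "arc_first n B \<in> B \<and> arc_first n B \<in> {1..n}" if B: "B \<in> Q" for B
  proof -
    obtain a k where ak: "a \<in> {1..n}" "0 < k" "k < n" "B = arc n a k"
      using form[OF B] by blast
    have "a = cyc n (a + 0)" using ak(1) by (simp add: cyc_id)
    then have "a \<in> B" using ak unfolding arc_def by blast
    then show ?thesis using ak arc_first_arc by simp
  qed
  have block: "block_at n ?R (arc_first n B) = B" if B: "B \<in> Q" for B
  proof -
    obtain a k where ak: "a \<in> {1..n}" "0 < k" "k < n" "B = arc n a k"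
      using form[OF B] by blast
    have fa: "arc_first n B = a" using ak arc_first_arc by simp
    have nin: "cyc n (a + k) \<notin> B"
    proof
      assume "cyc n (a + k) \<in> B"
      then obtain t where "t < k" "cyc n (a + k) = cyc n (a + t)"
        using ak(4) unfolding arc_def by blast
      then show False using cyc_add_inj[OF n, of a k t] ak(3) by simp
    qed
    obtain B' where B': "B' \<in> Q" "cyc n (a + k) \<in> B'"
      using part cyc_in[OF n, of "a + k"] unfolding partition_on_def by blast
    obtain b l where bl: "b \<in> {1..n}" "0 < l" "l < n" "B' = arc n b l"
      using form[OF B'(1)] by blast
    obtain t where t: "t < l" "cyc n (a + k) = cyc n (b + t)"
      using B'(2) bl unfolding arc_def by blast
    have "t = 0"
    proof (rule ccontr)
      assume "t \<noteq> 0"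
      have "cyc n ((a + (k - 1)) + 1) = cyc n ((b + (t - 1)) + 1)"
        using t(2) ak(2) \<open>t \<noteq> 0\<close> by simp
      then have "cyc n (a + (k - 1)) = cyc n (b + (t - 1))"
        by (rule cyc_cancel[OF n])
      moreover have "cyc n (a + (k - 1)) \<in> B"
        unfolding ak(4) arc_def using ak(2) by (intro CollectI exI[of _ "k - 1"]) simp
      moreover have "cyc n (b + (t - 1)) \<in> B'"
        using bl t(1) unfolding arc_def by force
      ultimately have "B = B'" using same B B'(1) by metis
      with nin B' show False by simp
    qed
    with t bl have "cyc n (a + k) = arc_first n B'"
      by (simp add: cyc_id arc_first_arc)
    with B' have next_root: "cyc n (a + k) \<in> ?R" by blast
    have "gap n ?R a = k"
    proof (rule gap_eqI[OF ak(2) next_root])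
      fix t assume t: "0 < t" "t < k"
      show "cyc n (a + t) \<notin> ?R"
      proof
        assume "cyc n (a + t) \<in> ?R"
        then obtain C where C: "C \<in> Q" "cyc n (a + t) = arc_first n C" by blast
        moreover have "cyc n (a + t) \<in> B" using ak t unfolding arc_def by blast
        ultimately have "C = B" using same[OF C(1) B] first_in[OF C(1)] by metis
        then have "cyc n (a + t) = cyc n a" using C fa ak(1) by (simp add: cyc_id)
        then show False using cyc_add_neq[OF n, of t a] t ak by simp
      qed
    qed
    then show ?thesis using fa ak unfolding block_at_def by simp
  qed
  show "?R \<subseteq> {1..n}" using first_in by blast
  show "Q = blocks n ?R"
    unfolding blocks_def image_image using block by simp
  have "inj_on (arc_first n) Q" by (rule inj_onI) (metis block)
  then show "card ?R = card Q" by (rule card_image)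
qed

lemma circ_partition_whole:
  assumes "0 < n" "circ_partition n Q" "\<not> 2 \<le> card Q" "a \<in> {1..n}"
  shows "Q = blocks n {a}"
proof -
  have part: "partition_on {1..n} Q"
    using assms(2) unfolding circ_partition_def by blast
  then have "finite Q" using finite_elements[of "{1..n}" Q] by simp
  moreover have "Q \<noteq> {}" using part assms(1) unfolding partition_on_def by auto
  ultimately have "card Q = 1" using assms(3) card_0_eq[of Q] by linarith
  then obtain B where "Q = {B}" by (auto simp: card_1_singleton_iff)
  then have "Q = {{1..n}}" using part unfolding partition_on_def by simp
  moreover have "card (blocks n {a}) = 1"
    using assms(1,4) by (subst card_blocks) auto
  then obtain C where "blocks n {a} = {C}" by (auto simp: card_1_singleton_iff)
  then have "blocks n {a} = {{1..n}}"
    using circ_partition_blocks[OF assms(1), of "{a}"] assms(4)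
    unfolding circ_partition_def partition_on_def by simp
  ultimately show ?thesis by simp
qed


section \<open>Scanning for records\<close>

definition is_record :: "(nat \<Rightarrow> sign) \<Rightarrow> (nat \<Rightarrow> nat) \<Rightarrow> nat \<Rightarrow> nat \<Rightarrow> bool" where
  "is_record s \<sigma> h x \<longleftrightarrow> s x = SPlus \<and> \<sigma> x > h \<or> s x = SMinus \<and> \<sigma> x < h"

lemma scan_records_Cons:
  "scan_records s \<sigma> h (x # xs) =
     (if is_record s \<sigma> h x then x # scan_records s \<sigma> (\<sigma> x) xs else scan_records s \<sigma> h xs)"
  by (simp add: is_record_def)

text \<open>The scan described without its state: the current threshold is the label at the last offset
  in \<open>T\<close>. In this form it can be compared with the validity of a partition.\<close>

definition record_offsets ::
  "(nat \<Rightarrow> sign) \<Rightarrow> (nat \<Rightarrow> nat) \<Rightarrow> (nat \<Rightarrow> nat) \<Rightarrow> nat \<Rightarrow> nat set \<Rightarrow> bool" where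
  "record_offsets s \<sigma> v n T \<longleftrightarrow> 0 \<in> T \<and>
     (\<forall>a\<in>T. \<forall>t<n. a < t \<and> {a<..<t} \<inter> T = {} \<longrightarrow> (t \<in> T \<longleftrightarrow> is_record s \<sigma> (\<sigma> (v a)) (v t)))"

lemma scan_records_filter:
  assumes "record_offsets s \<sigma> v n T" "a \<in> T" "a < t" "t \<le> n" "{a<..<t} \<inter> T = {}"
  shows "scan_records s \<sigma> (\<sigma> (v a)) (map v [t..<n]) = map v (filter (\<lambda>u. u \<in> T) [t..<n])"
  using assms(2-)
proof (induction "n - t" arbitrary: a t)
  case 0
  then show ?case by simp
next
  case (Suc m)
  then have t: "t < n" "m = n - Suc t" by auto
  have rec: "t \<in> T \<longleftrightarrow> is_record s \<sigma> (\<sigma> (v a)) (v t)"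
    using assms(1) Suc.prems t(1) unfolding record_offsets_def by blast
  have upt: "[t..<n] = t # [Suc t..<n]" using t(1) by (rule upt_conv_Cons)
  show ?case
  proof (cases "t \<in> T")
    case True
    have "{t<..<Suc t} \<inter> T = {}" by auto
    then have "scan_records s \<sigma> (\<sigma> (v t)) (map v [Suc t..<n]) = map v (filter (\<lambda>u. u \<in> T) [Suc t..<n])"
      using Suc.hyps(1)[OF t(2) True] t(1) by simp
    with True rec show ?thesis by (simp add: upt scan_records_Cons del: scan_records.simps)
  next
    case False
    then have "{a<..<Suc t} \<inter> T = {}"
      using Suc.prems(4) by (auto simp: less_Suc_eq)
    then have "scan_records s \<sigma> (\<sigma> (v a)) (map v [Suc t..<n]) = map v (filter (\<lambda>u. u \<in> T) [Suc t..<n])"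
      using Suc.hyps(1)[OF t(2) Suc.prems(1)] Suc.prems(2) t(1) by simp
    with False rec show ?thesis by (simp add: upt scan_records_Cons del: scan_records.simps)
  qed
qed

text \<open>The current threshold of the scan after it has inspected offset \<open>t\<close>; following it shows
  that the implicit description has a solution.\<close>

primrec threshold :: "(nat \<Rightarrow> sign) \<Rightarrow> (nat \<Rightarrow> nat) \<Rightarrow> (nat \<Rightarrow> nat) \<Rightarrow> nat \<Rightarrow> nat" where
  "threshold s \<sigma> v 0 = \<sigma> (v 0)"
| "threshold s \<sigma> v (Suc t) =
     (if is_record s \<sigma> (threshold s \<sigma> v t) (v (Suc t)) then \<sigma> (v (Suc t)) else threshold s \<sigma> v t)"

lemma record_offsets_exist: "\<exists>T. record_offsets s \<sigma> v n T"
proof -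
  define T where "T = {t. t = 0 \<or> is_record s \<sigma> (threshold s \<sigma> v (t - 1)) (v t)}"
  have thr: "threshold s \<sigma> v (a + d) = \<sigma> (v a)" if "a \<in> T" "{a<..<a + d + 1} \<inter> T = {}" for a d
    using that(2)
  proof (induction d)
    case 0
    then show ?case using that(1) by (cases a) (auto simp: T_def)
  next
    case (Suc d)
    have "a + Suc d \<in> {a<..<a + Suc d + 1}" by simp
    with Suc.prems have nin: "a + Suc d \<notin> T" by blast
    have "{a<..<a + d + 1} \<subseteq> {a<..<a + Suc d + 1}" by auto
    then have "{a<..<a + d + 1} \<inter> T = {}" using Suc.prems by blast
    with nin show ?case using Suc.IH by (simp add: T_def)
  qed
  have "t \<in> T \<longleftrightarrow> is_record s \<sigma> (\<sigma> (v a)) (v t)" if "a \<in> T" "a < t" "{a<..<t} \<inter> T = {}" for a t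
  proof -
    have "t = a + (t - a - 1) + 1" using that(2) by simp
    then have "threshold s \<sigma> v (t - 1) = \<sigma> (v a)"
      using thr[OF that(1), of "t - a - 1"] that(3) by (metis add_diff_cancel_right')
    then show ?thesis using that(2) by (simp add: T_def)
  qed
  moreover have "0 \<in> T" by (simp add: T_def)
  ultimately show ?thesis unfolding record_offsets_def by blast
qed

lemma scan_records_map:
  assumes "\<And>i. i \<in> set ps \<Longrightarrow> s (g i) = \<eta> i" "\<And>i. i \<in> set ps \<Longrightarrow> \<sigma> (g i) = \<pi> i"
  shows "map g (scan_records \<eta> \<pi> h ps) = scan_records s \<sigma> h (map g ps)"
  using assms by (induction ps arbitrary: h) auto

lemma the_argmax:
  fixes f :: "'a \<Rightarrow> nat"
  assumes "finite A" "inj_on f A" "a \<in> A" "\<And>x. x \<in> A \<Longrightarrow> f x \<le> f a"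
  shows "(THE j. j \<in> A \<and> f j = Max (f ` A)) = a"
proof -
  have "Max (f ` A) = f a"
    using assms by (intro Max_eqI) auto
  with assms show ?thesis by (auto intro!: the_equality dest: inj_onD)
qed

lemma argmax_exists:
  fixes f :: "'a \<Rightarrow> nat"
  assumes "finite A" "A \<noteq> {}"
  obtains a where "a \<in> A" "\<And>x. x \<in> A \<Longrightarrow> f x \<le> f a"
proof -
  have "Max (f ` A) \<in> f ` A" using assms by (intro Max_in) auto
  then obtain a where "a \<in> A" "f a = Max (f ` A)" by auto
  with assms that show ?thesis by simp
qed


section \<open>Valid partitions and records\<close>

locale labelled_cycle =
  fixes n :: nat and \<delta> :: "nat \<Rightarrow> sign" and \<sigma> :: "nat \<Rightarrow> nat"
  assumes twice: "both_signs_twice n \<delta>" and inj: "inj_on \<sigma> {1..n}"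
begin

abbreviation direction :: "nat \<Rightarrow> sign" where
  "direction j \<equiv> - \<delta> (cyc_pred n j)"

abbreviation top_root :: nat where
  "top_root \<equiv> largest_ascent n \<delta> \<sigma>"

abbreviation from_top :: "nat \<Rightarrow> nat" where
  "from_top t \<equiv> cyc n (top_root + t)"

abbreviation root_list :: "nat list" where
  "root_list \<equiv> top_root # scan_records direction \<sigma> (\<sigma> top_root) (map from_top [1..<n])"

lemma n_pos: "0 < n"
  using twice by (rule both_signs_twice_imp_pos)

lemma ascent_iff: "ascent_vertex n \<delta> j \<longleftrightarrow> j \<in> {1..n} \<and> direction j = SPlus"
  using ascent_descent_vertex_iff(1)[OF twice, of j]
  by (cases "\<delta> (cyc_pred n j)") (auto simp: ascent_vertex_def)

lemma descent_iff: "descent_vertex n \<delta> j \<longleftrightarrow> j \<in> {1..n} \<and> direction j = SMinus"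
  using ascent_descent_vertex_iff(2)[OF twice, of j]
  by (cases "\<delta> (cyc_pred n j)") (auto simp: descent_vertex_def)

lemma largest_ascent_eqI:
  assumes "ascent_vertex n \<delta> a" "\<And>x. ascent_vertex n \<delta> x \<Longrightarrow> \<sigma> x \<le> \<sigma> a"
  shows "top_root = a"
proof -
  let ?A = "{j. ascent_vertex n \<delta> j}"
  have sub: "?A \<subseteq> {1..n}" by (auto simp: ascent_vertex_def)
  then have "finite ?A" "inj_on \<sigma> ?A"
    using inj inj_on_subset finite_subset by blast+
  then show ?thesis
    using the_argmax[of ?A \<sigma> a] assms unfolding largest_ascent_def by simp
qed

lemma top_root: "ascent_vertex n \<delta> top_root" "ascent_vertex n \<delta> x \<Longrightarrow> \<sigma> x \<le> \<sigma> top_root"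
proof -
  let ?A = "{j. ascent_vertex n \<delta> j}"
  have "finite ?A" by (rule finite_subset[of _ "{1..n}"]) (auto simp: ascent_vertex_def)
  moreover obtain i where i: "i \<in> {1..n}" "\<delta> i = SMinus"
    using twice unfolding both_signs_twice_iff by blast
  then have "(i, cyc n (i + 1)) \<in> cyc_less n \<delta>"
    by (simp only: cyc_less_neighbour_iff[OF twice i(1)])
  moreover have "cyc_pred n (cyc n (i + 1)) = i"
  proof -
    have "cyc_pred n (cyc n (i + 1)) = cyc n (cyc n (i + 1) + (n - 1))"
      using n_pos by (simp add: cyc_pred_def)
    also have "\<dots> = cyc n (i + n)"
      using cyc_add_diff[OF n_pos, of 1 n i] n_pos by simp
    finally show ?thesis using i(1) n_pos by (simp add: cyc_add_n cyc_id)
  qed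
  ultimately have "finite ?A" "cyc n (i + 1) \<in> ?A"
    using cyc_in[OF n_pos] by (auto simp: ascent_vertex_def)
  then obtain a where "a \<in> ?A" "\<And>x. x \<in> ?A \<Longrightarrow> \<sigma> x \<le> \<sigma> a"
    using argmax_exists[of ?A \<sigma>] by blast
  with largest_ascent_eqI[of a]
  show "ascent_vertex n \<delta> top_root" "ascent_vertex n \<delta> x \<Longrightarrow> \<sigma> x \<le> \<sigma> top_root"
    by auto
qed

lemma top_root_in: "top_root \<in> {1..n}"
  using top_root(1) by (simp add: ascent_vertex_def)

lemma block_root_block_at:
  assumes "R \<subseteq> {1..n}" "a \<in> R" "top_root \<in> R \<or> 2 \<le> card R"
  shows "block_root n \<delta> \<sigma> (blocks n R) (block_at n R a) = a"
proof (cases "2 \<le> card R")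
  case True
  then show ?thesis
    using arc_first_block_at[OF n_pos assms(1,2)] by (simp add: block_root_def card_blocks[OF n_pos assms(1)])
next
  case False
  have "a = top_root"
  proof (rule ccontr)
    assume "a \<noteq> top_root"
    then have "card {a, top_root} \<le> card R"
      using assms False finite_subset[OF assms(1)] by (intro card_mono) auto
    with \<open>a \<noteq> top_root\<close> False show False by simp
  qed
  then show ?thesis
    using False by (simp add: block_root_def card_blocks[OF n_pos assms(1)])
qed

text \<open>Since labels are distinct, the inequalities of condition (i) are the negation of the record
  test, and those of condition (ii) are the test itself.\<close>

lemma valid_blocks_iff:
  assumes "R \<subseteq> {1..n}" "R \<noteq> {}" "top_root \<in> R \<or> 2 \<le> card R"
  shows "valid_circ_partition n \<delta> \<sigma> (blocks n R) \<longleftrightarrow>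
    (\<forall>a\<in>R. \<forall>t. 0 < t \<and> t < gap n R a \<longrightarrow> \<not> is_record direction \<sigma> (\<sigma> a) (cyc n (a + t))) \<and>
    (2 \<le> card R \<longrightarrow> (\<forall>a\<in>R. is_record direction \<sigma> (\<sigma> a) (cyc n (a + gap n R a))))"
proof -
  have nonroots: "block_at n R a - {a} = {cyc n (a + t) | t. 0 < t \<and> t < gap n R a}" if "a \<in> R" for a
  proof -
    have a: "a \<in> {1..n}" using that assms(1) by blast
    have "cyc n (a + t) = a \<longleftrightarrow> t = 0" if "t < gap n R a" for t
      using cyc_add_neq[OF n_pos, of t a] cyc_id[OF a] that gap_props(2)[OF n_pos assms(1) \<open>a \<in> R\<close>]
      by (cases "t = 0") auto
    then show ?thesis
      unfolding block_at_def arc_def by (auto intro: gr0I)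
  qed
  have inside: "(ascent_vertex n \<delta> x \<longrightarrow> \<sigma> x < \<sigma> a) \<and> (descent_vertex n \<delta> x \<longrightarrow> \<sigma> x > \<sigma> a) \<longleftrightarrow>
      \<not> is_record direction \<sigma> (\<sigma> a) x" if "a \<in> R" "x \<in> block_at n R a - {a}" for a x
  proof -
    have "x \<in> {1..n}" "a \<in> {1..n}" "x \<noteq> a"
      using that assms(1) arc_subset[OF n_pos] unfolding block_at_def by blast+
    then have "\<sigma> x \<noteq> \<sigma> a" "x \<in> {1..n}" using inj by (auto dest: inj_onD)
    then show ?thesis
      by (auto simp: ascent_iff descent_iff is_record_def simp del: atLeastAtMost_iff)
  qed
  have next_root: "(ascent_vertex n \<delta> x \<longrightarrow> \<sigma> x > \<sigma> a) \<and> (descent_vertex n \<delta> x \<longrightarrow> \<sigma> x < \<sigma> a) \<longleftrightarrow>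
      is_record direction \<sigma> (\<sigma> a) x" if "x \<in> {1..n}" for a x
    using that by (cases "direction x")
      (auto simp: ascent_iff descent_iff is_record_def simp del: atLeastAtMost_iff)
  have "(\<forall>a\<in>R. \<forall>b\<in>R. arc_follows n (block_at n R a) (block_at n R b) \<longrightarrow>
        (ascent_vertex n \<delta> b \<longrightarrow> \<sigma> b > \<sigma> a) \<and> (descent_vertex n \<delta> b \<longrightarrow> \<sigma> b < \<sigma> a)) \<longleftrightarrow>
      (\<forall>a\<in>R. is_record direction \<sigma> (\<sigma> a) (cyc n (a + gap n R a)))" if "2 \<le> card R"
    using arc_follows_block_at[OF n_pos assms(1) _ _ that] gap_props(3)[OF n_pos assms(1)]
      next_root[OF cyc_in[OF n_pos]] by simp
  moreover have "(\<forall>a\<in>R. \<forall>x\<in>block_at n R a - {a}. (ascent_vertex n \<delta> x \<longrightarrow> \<sigma> x < \<sigma> a) \<and>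
        (descent_vertex n \<delta> x \<longrightarrow> \<sigma> x > \<sigma> a)) \<longleftrightarrow>
      (\<forall>a\<in>R. \<forall>t. 0 < t \<and> t < gap n R a \<longrightarrow> \<not> is_record direction \<sigma> (\<sigma> a) (cyc n (a + t)))"
    using inside nonroots by (simp cong: ball_cong) blast
  ultimately show ?thesis
    unfolding valid_circ_partition_def
    using circ_partition_blocks[OF n_pos assms(1,2)] block_root_block_at[OF assms(1) _ assms(3)]
    by (simp add: Let_def card_blocks[OF n_pos assms(1)]) (simp add: blocks_def cong: ball_cong)
qed

text \<open>Around the cycle, a root that is a descent vertex has a smaller label than the root before it.
  So the largest root label belongs to an ascent vertex, and no ascent vertex inside a block can
  exceed it.\<close>

lemma valid_imp_top_root:
  assumes "R \<subseteq> {1..n}" "2 \<le> card R" "valid_circ_partition n \<delta> \<sigma> (blocks n R)"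
  shows "top_root \<in> R"
proof (rule ccontr)
  assume top: "top_root \<notin> R"
  have R: "finite R" "R \<noteq> {}"
    using assms(1,2) finite_subset by fastforce+
  have inside: "\<not> is_record direction \<sigma> (\<sigma> a) (cyc n (a + t))" if "a \<in> R" "0 < t" "t < gap n R a" for a t
    using valid_blocks_iff[OF assms(1) R(2)] assms(2,3) that by blast
  have step: "is_record direction \<sigma> (\<sigma> a) (cyc n (a + gap n R a))" if "a \<in> R" for a
    using valid_blocks_iff[OF assms(1) R(2)] assms(2,3) that by blast
  \<comment> \<open>The root \<open>m\<close> with the largest label is preceded by a root \<open>a\<close>, and only an ascent vertex
    can be a record with a label at least as large as that of \<open>a\<close>.\<close>
  obtain m where m: "m \<in> R" "\<And>x. x \<in> R \<Longrightarrow> \<sigma> x \<le> \<sigma> m"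
    using argmax_exists[OF R] by blast
  obtain a where a: "a \<in> R" "cyc_pred n m \<in> block_at n R a"
    using blocks_cover[OF n_pos assms(1) R(2) cyc_pred_in[OF n_pos]] by blast
  then obtain t where t: "t < gap n R a" "cyc_pred n m = cyc n (a + t)"
    unfolding block_at_def arc_def by blast
  have m_eq: "m = cyc n (a + Suc t)"
    using cyc_pred_succ[of m n] m(1) assms(1) t(2) cyc_cyc_add[OF n_pos, of "a + t" 1] by auto
  then have "Suc t = gap n R a"
    using gap_props(4)[OF n_pos assms(1) a(1), of "Suc t"] m(1) t(1) by (cases "Suc t = gap n R a") auto
  then have "is_record direction \<sigma> (\<sigma> a) m"
    using step[OF a(1)] m_eq by simp
  then have "direction m = SPlus"
    using m(2)[OF a(1)] by (auto simp: is_record_def)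
  then have "\<sigma> m \<le> \<sigma> top_root"
    using m(1) assms(1) by (intro top_root(2)) (auto simp: ascent_iff)
  obtain b where b: "b \<in> R" "top_root \<in> block_at n R b"
    using blocks_cover[OF n_pos assms(1) R(2) top_root_in] by blast
  then obtain u where u: "u < gap n R b" "top_root = cyc n (b + u)"
    unfolding block_at_def arc_def by blast
  have "u \<noteq> 0"
    using u(2) top b(1) cyc_id[of b n] assms(1) by (metis add_0_right subsetD)
  then have "\<not> is_record direction \<sigma> (\<sigma> b) top_root"
    using inside[OF b(1), of u] u by simp
  then have "\<sigma> top_root \<le> \<sigma> b"
    using top_root(1) by (auto simp: ascent_iff is_record_def)
  with \<open>\<sigma> m \<le> \<sigma> top_root\<close> m(2)[OF b(1)] have "\<sigma> top_root = \<sigma> b" by simp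
  then have "top_root = b"
    using inj b(1) assms(1) top_root_in by (auto dest: inj_onD simp del: atLeastAtMost_iff)
  with top b(1) show False by simp
qed

abbreviation root_offsets :: "nat set \<Rightarrow> nat set" where
  "root_offsets R \<equiv> {t. t < n \<and> from_top t \<in> R}"

lemma from_top_0: "from_top 0 = top_root"
  using top_root_in by (simp add: cyc_id)

lemma from_top_n: "from_top n = top_root"
  using top_root_in by (simp add: cyc_id cyc_add_n n_pos)

lemma from_top_onto: "x \<in> {1..n} \<Longrightarrow> \<exists>t<n. x = from_top t"
  using cyc_reach[OF top_root_in] by blast

lemma from_top_add: "cyc n (from_top s + t) = from_top (s + t)"
  by (simp add: cyc_cyc_add n_pos add.assoc)

lemma from_top_diff: "s < t \<Longrightarrow> cyc n (from_top s + (t - s)) = from_top t"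
  by (rule cyc_add_diff[OF n_pos less_imp_le])

lemma gap_from_top:
  assumes "R \<subseteq> {1..n}" "top_root \<in> R" "s < n" "from_top s \<in> R"
  shows "s + gap n R (from_top s) \<le> n"
    and "\<And>u. s < u \<Longrightarrow> u < s + gap n R (from_top s) \<Longrightarrow> from_top u \<notin> R"
    and "from_top (s + gap n R (from_top s)) \<in> R"
proof -
  show below: "from_top u \<notin> R" if "s < u" "u < s + gap n R (from_top s)" for u
    unfolding from_top_diff[OF that(1), symmetric]
    using that by (intro gap_props(4)[OF n_pos assms(1,4)]) auto
  show "from_top (s + gap n R (from_top s)) \<in> R"
    using gap_props(3)[OF n_pos assms(1,4)] by (simp add: from_top_add)
  show "s + gap n R (from_top s) \<le> n"
    using below[OF assms(3)] assms(2) from_top_n by force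
qed

text \<open>An ascent vertex is below the top one by choice of the top, and a record at a descent vertex
  lowers the threshold.\<close>

lemma record_label_le_top:
  assumes "record_offsets direction \<sigma> from_top n T" "s \<in> T" "s < n"
  shows "\<sigma> (from_top s) \<le> \<sigma> top_root"
  using assms(2,3)
proof (induction s rule: less_induct)
  case (less s)
  show ?case
  proof (cases "s = 0")
    case True
    then show ?thesis using from_top_0 by simp
  next
    case False
    define a where "a = Max (T \<inter> {..<s})"
    have "0 \<in> T \<inter> {..<s}"
      using assms(1) False unfolding record_offsets_def by auto
    then have a: "a \<in> T" "a < s" "{a<..<s} \<inter> T = {}"
      using Max_in[of "T \<inter> {..<s}"] Max_ge[of "T \<inter> {..<s}"] unfolding a_def by fastforce+
    then have "is_record direction \<sigma> (\<sigma> (from_top a)) (from_top s)"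
      using assms(1) less.prems unfolding record_offsets_def by blast
    then consider "direction (from_top s) = SPlus" | "\<sigma> (from_top s) < \<sigma> (from_top a)"
      unfolding is_record_def by blast
    then show ?thesis
    proof cases
      case 1
      then show ?thesis
        using cyc_in[OF n_pos] by (intro top_root(2)) (simp only: ascent_iff)
    next
      case 2
      then show ?thesis using less.IH[of a] a less.prems by simp
    qed
  qed
qed

text \<open>The two conditions differ only at the closing of the cycle, where validity compares the last
  root with the first. That comparison always succeeds, because the initial threshold bounds
  all later ones.\<close>

lemma valid_iff_record_offsets:
  assumes R: "R \<subseteq> {1..n}" "top_root \<in> R"
  shows "valid_circ_partition n \<delta> \<sigma> (blocks n R) \<longleftrightarrow>
    record_offsets direction \<sigma> from_top n (root_offsets R)"
proof
  assume "valid_circ_partition n \<delta> \<sigma> (blocks n R)"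
  then have inside: "\<And>a t. a \<in> R \<Longrightarrow> 0 < t \<Longrightarrow> t < gap n R a \<Longrightarrow> \<not> is_record direction \<sigma> (\<sigma> a) (cyc n (a + t))"
    and step: "\<And>a. 2 \<le> card R \<Longrightarrow> a \<in> R \<Longrightarrow> is_record direction \<sigma> (\<sigma> a) (cyc n (a + gap n R a))"
    using valid_blocks_iff[of R] R by blast+
  have "t \<in> root_offsets R \<longleftrightarrow> is_record direction \<sigma> (\<sigma> (from_top a)) (from_top t)"
    if a: "a \<in> root_offsets R" and t: "t < n" "a < t" "{a<..<t} \<inter> root_offsets R = {}" for a t
  proof
    assume tR: "t \<in> root_offsets R"
    have "gap n R (from_top a) = t - a"
    proof (rule gap_eqI)
      show "cyc n (from_top a + (t - a)) \<in> R" unfolding from_top_diff[OF t(2)] using tR by simp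
      show "cyc n (from_top a + u) \<notin> R" if "0 < u" "u < t - a" for u
      proof -
        have "a + u \<in> {a<..<t}" "a + u < n" using that t(1) by simp_all
        with t(3) have "from_top (a + u) \<notin> R" by blast
        then show ?thesis by (simp only: from_top_add not_False_eq_True)
      qed
    qed (use t(2) in simp)
    moreover have "2 \<le> card R"
    proof -
      have "from_top t \<noteq> top_root"
        using cyc_add_neq[OF n_pos, of t top_root] t from_top_0 by simp
      then have "card {from_top t, top_root} = 2" by simp
      moreover have "card {from_top t, top_root} \<le> card R"
        using tR R finite_subset[OF R(1)] by (intro card_mono) auto
      ultimately show ?thesis by simp
    qed
    ultimately show "is_record direction \<sigma> (\<sigma> (from_top a)) (from_top t)"
      using step[of "from_top a"] a from_top_diff[OF t(2)] by simp
  next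
    assume rec: "is_record direction \<sigma> (\<sigma> (from_top a)) (from_top t)"
    show "t \<in> root_offsets R"
    proof (rule ccontr)
      assume nt: "t \<notin> root_offsets R"
      have aR: "a < n" "from_top a \<in> R" using a by auto
      let ?g = "a + gap n R (from_top a)"
      have "t < ?g"
      proof (rule ccontr)
        assume "\<not> t < ?g"
        then have "?g \<in> root_offsets R"
          using gap_from_top(3)[OF R aR] t(1) by simp
        moreover have "a < ?g" using gap_props(1)[OF n_pos R(1) aR(2)] by simp
        ultimately have "?g \<noteq> t \<longrightarrow> ?g \<in> {a<..<t} \<inter> root_offsets R"
          using \<open>\<not> t < ?g\<close> by auto
        with t(3) nt \<open>?g \<in> root_offsets R\<close> show False by blast
      qed
      then have "\<not> is_record direction \<sigma> (\<sigma> (from_top a)) (cyc n (from_top a + (t - a)))"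
        using t(2) aR by (intro inside) auto
      with rec show False unfolding from_top_diff[OF t(2)] by simp
    qed
  qed
  moreover have "0 \<in> root_offsets R" using R(2) n_pos from_top_0 by simp
  ultimately show "record_offsets direction \<sigma> from_top n (root_offsets R)"
    unfolding record_offsets_def by blast
next
  assume rec: "record_offsets direction \<sigma> from_top n (root_offsets R)"
  have next_offset: "t \<in> root_offsets R \<longleftrightarrow> is_record direction \<sigma> (\<sigma> (from_top s)) (from_top t)"
    if "s \<in> root_offsets R" "s < t" "t \<le> s + gap n R (from_top s)" "t < n" for s t
  proof -
    have "u \<notin> root_offsets R" if "u \<in> {s<..<t}" for u
      using gap_from_top(2)[OF R, of s u] that \<open>s \<in> root_offsets R\<close> \<open>t \<le> _\<close> by simp
    then have "{s<..<t} \<inter> root_offsets R = {}" by blast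
    then show ?thesis
      using rec that unfolding record_offsets_def by blast
  qed
  have offset: "\<exists>s. s \<in> root_offsets R \<and> a = from_top s" if "a \<in> R" for a
    using from_top_onto[of a] that R(1) by blast
  have "\<not> is_record direction \<sigma> (\<sigma> a) (cyc n (a + t))" if "a \<in> R" "0 < t" "t < gap n R a" for a t
  proof -
    obtain s where s: "s \<in> root_offsets R" "a = from_top s"
      using offset[OF \<open>a \<in> R\<close>] by blast
    then have "s + t < n" "from_top (s + t) \<notin> R"
      using gap_from_top(1,2)[OF R, of s] that by auto
    then show ?thesis
      using next_offset[OF s(1), of "s + t"] that s(2) by (simp add: from_top_add)
  qed
  moreover have "is_record direction \<sigma> (\<sigma> a) (cyc n (a + gap n R a))" if "2 \<le> card R" "a \<in> R" for a
  proof -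
    obtain s where s: "s \<in> root_offsets R" "a = from_top s"
      using offset[OF \<open>a \<in> R\<close>] by blast
    let ?g = "s + gap n R a"
    have g: "?g \<le> n" "from_top ?g \<in> R" "0 < gap n R a" "gap n R a < n"
      using gap_from_top(1,3)[OF R, of s] s gap_props(1)[OF n_pos R(1) that(2)]
        gap_less[OF n_pos R(1) that(2,1)] by auto
    have "is_record direction \<sigma> (\<sigma> a) (from_top ?g)"
    proof (cases "?g = n")
      case False
      then show ?thesis
        using next_offset[OF s(1), of ?g] g s(2) by simp
    next
      case True
      then have "s \<noteq> 0" using g(4) by (intro notI) simp
      then have "a \<noteq> top_root"
        using cyc_add_neq[OF n_pos, of s top_root] s from_top_0 by simp
      then have "\<sigma> a \<noteq> \<sigma> top_root"
        using inj that(2) R(1) top_root_in by (metis inj_onD subsetD)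
      moreover have "\<sigma> a \<le> \<sigma> top_root"
        using record_label_le_top[OF rec s(1)] s by simp
      ultimately show ?thesis
        using True top_root(1) by (simp add: from_top_n is_record_def ascent_iff)
    qed
    then show ?thesis using s(2) by (simp add: from_top_add)
  qed
  ultimately show "valid_circ_partition n \<delta> \<sigma> (blocks n R)"
    using valid_blocks_iff[of R] R by blast
qed

lemma root_list_filter:
  assumes "record_offsets direction \<sigma> from_top n T"
  shows "root_list = map from_top (filter (\<lambda>t. t \<in> T) [0..<n])"
proof -
  have T0: "0 \<in> T" using assms unfolding record_offsets_def by blast
  have "[0..<n] = 0 # [1..<n]" using n_pos by (simp add: upt_conv_Cons)
  moreover have "scan_records direction \<sigma> (\<sigma> (from_top 0)) (map from_top [1..<n]) =
      map from_top (filter (\<lambda>t. t \<in> T) [1..<n])"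
    using n_pos by (intro scan_records_filter[OF assms T0]) auto
  ultimately show ?thesis using T0 from_top_0 by simp
qed

lemma record_offsets_root_list:
  "set root_list \<subseteq> {1..n}"
  "record_offsets direction \<sigma> from_top n (root_offsets (set root_list))"
proof -
  obtain T where T: "record_offsets direction \<sigma> from_top n T"
    using record_offsets_exist by blast
  have L: "set root_list = from_top ` {t. t < n \<and> t \<in> T}"
    unfolding root_list_filter[OF T] by auto
  show "set root_list \<subseteq> {1..n}"
    unfolding L using cyc_in[OF n_pos] by blast
  have "from_top t \<in> set root_list \<longleftrightarrow> t \<in> T" if "t < n" for t
    unfolding L using that cyc_add_inj[OF n_pos, of top_root] by blast
  then have *: "t \<in> root_offsets (set root_list) \<longleftrightarrow> t \<in> T" if "t < n" for t
    using that by blast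
  have T0: "0 \<in> T" using T unfolding record_offsets_def by blast
  have "t \<in> root_offsets (set root_list) \<longleftrightarrow> is_record direction \<sigma> (\<sigma> (from_top a)) (from_top t)"
    if a: "a \<in> root_offsets (set root_list)" and t: "t < n" "a < t"
      "{a<..<t} \<inter> root_offsets (set root_list) = {}" for a t
  proof -
    have "a \<in> T" using a * by blast
    moreover have "{a<..<t} \<inter> T = {}"
    proof (rule ccontr)
      assume "{a<..<t} \<inter> T \<noteq> {}"
      then obtain u where u: "u \<in> {a<..<t}" "u \<in> T" by blast
      then have "u < n" using t(1) by simp
      with u * have "u \<in> root_offsets (set root_list)" by blast
      with u t(3) show False by blast
    qed
    ultimately have "t \<in> T \<longleftrightarrow> is_record direction \<sigma> (\<sigma> (from_top a)) (from_top t)"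
      using T t(1,2) unfolding record_offsets_def by blast
    with *[OF t(1)] show ?thesis by blast
  qed
  moreover have "0 \<in> root_offsets (set root_list)" using *[OF n_pos] T0 by blast
  ultimately show "record_offsets direction \<sigma> from_top n (root_offsets (set root_list))"
    unfolding record_offsets_def by blast
qed

text \<open>The records are the only set of roots that satisfies the rule of the scan, so existence and
  uniqueness of the valid partition come together.\<close>

lemma valid_iff_root_list:
  "valid_circ_partition n \<delta> \<sigma> Q \<longleftrightarrow> Q = blocks n (set root_list)"
proof
  have top: "top_root \<in> set root_list" by simp
  show "valid_circ_partition n \<delta> \<sigma> Q" if "Q = blocks n (set root_list)"
    unfolding that valid_iff_record_offsets[OF record_offsets_root_list(1) top]
    by (rule record_offsets_root_list(2))
  assume valid: "valid_circ_partition n \<delta> \<sigma> Q"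
  then have circ: "circ_partition n Q" unfolding valid_circ_partition_def by blast
  have "\<exists>R \<subseteq> {1..n}. top_root \<in> R \<and> Q = blocks n R"
  proof (cases "2 \<le> card Q")
    case True
    then show ?thesis
      using circ_partition_first_vertices[OF n_pos circ True] True valid
        valid_imp_top_root[of "arc_first n ` Q"]
      by (intro exI[of _ "arc_first n ` Q"]) simp
  next
    case False
    then show ?thesis
      using circ_partition_whole[OF n_pos circ False top_root_in] top_root_in by blast
  qed
  then obtain R where R: "R \<subseteq> {1..n}" "top_root \<in> R" "Q = blocks n R" by blast
  then have rec: "record_offsets direction \<sigma> from_top n (root_offsets R)"
    using valid valid_iff_record_offsets by blast
  have "set root_list = from_top ` root_offsets R"
    unfolding root_list_filter[OF rec] by auto
  also have "\<dots> = R"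
  proof
    show "R \<subseteq> from_top ` root_offsets R"
      using from_top_onto R(1) by fastforce
  qed auto
  finally show "Q = blocks n (set root_list)" using R(3) by simp
qed

lemma the_circ_partition_eq: "the_circ_partition n \<delta> \<sigma> = blocks n (set root_list)"
  unfolding the_circ_partition_def valid_iff_root_list by simp

lemma distinct_root_list: "distinct root_list"
proof -
  obtain T where T: "record_offsets direction \<sigma> from_top n T"
    using record_offsets_exist by blast
  have "inj_on from_top {..<n}"
    using cyc_add_inj[OF n_pos] by (auto intro!: inj_onI)
  then show ?thesis
    unfolding root_list_filter[OF T] distinct_map by (auto elim!: inj_on_subset)
qed

text \<open>Consecutive records are consecutive roots on the cycle, so their blocks follow each other.\<close>

lemma root_list_gap:
  assumes "Suc k < length root_list"
  shows "root_list ! Suc k = cyc n (root_list ! k + gap n (set root_list) (root_list ! k))"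
proof -
  let ?R = "set root_list"
  define ts where "ts = filter (\<lambda>t. t \<in> root_offsets ?R) [0..<n]"
  have L: "root_list = map from_top ts"
    unfolding ts_def by (rule root_list_filter[OF record_offsets_root_list(2)])
  have k: "Suc k < length ts" using assms unfolding L by simp
  have sorted: "sorted_wrt (<) ts"
    unfolding ts_def by (intro sorted_wrt_filter) simp
  have ts: "set ts = root_offsets ?R" unfolding ts_def by auto
  have less: "ts ! k < ts ! Suc k"
    using sorted k by (intro sorted_wrt_nth_less) auto
  have "gap n ?R (from_top (ts ! k)) = ts ! Suc k - ts ! k"
  proof (rule gap_eqI)
    show "0 < ts ! Suc k - ts ! k" using less by simp
    have "ts ! Suc k \<in> root_offsets ?R" using k ts nth_mem by blast
    then show "cyc n (from_top (ts ! k) + (ts ! Suc k - ts ! k)) \<in> ?R"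
      unfolding from_top_diff[OF less] by simp
    fix u assume u: "0 < u" "u < ts ! Suc k - ts ! k"
    show "cyc n (from_top (ts ! k) + u) \<notin> ?R"
    proof
      assume "cyc n (from_top (ts ! k) + u) \<in> ?R"
      then have "from_top (ts ! k + u) \<in> ?R" by (simp only: from_top_add)
      moreover have "ts ! k + u < n"
      proof -
        have "ts ! Suc k < n" using \<open>ts ! Suc k \<in> root_offsets ?R\<close> by blast
        with u show ?thesis by linarith
      qed
      ultimately have "ts ! k + u \<in> set ts" using ts by blast
      then obtain i where i: "i < length ts" "ts ! i = ts ! k + u"
        by (auto simp: in_set_conv_nth)
      have "\<not> i \<le> k" "\<not> Suc k \<le> i"
        using sorted_wrt_nth_less[OF sorted, of i k] sorted_wrt_nth_less[OF sorted, of "Suc k" i] i k u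
        by (cases "i = k"; cases "i = Suc k"; force)+
      then show False by simp
    qed
  qed
  then have "cyc n (from_top (ts ! k) + gap n ?R (from_top (ts ! k))) = from_top (ts ! Suc k)"
    by (simp only: from_top_diff[OF less])
  moreover have "root_list ! k = from_top (ts ! k)" "root_list ! Suc k = from_top (ts ! Suc k)"
    using k unfolding L by (simp_all del: nth_Cons_Suc)
  ultimately show ?thesis by metis
qed

lemma blocks_in_root_order:
  "\<exists>Bs. distinct Bs \<and> set Bs = the_circ_partition n \<delta> \<sigma> \<and>
     map (block_root n \<delta> \<sigma> (the_circ_partition n \<delta> \<sigma>)) Bs = root_list \<and>
     (\<forall>k. Suc k < length Bs \<longrightarrow> arc_follows n (Bs ! k) (Bs ! Suc k))"
proof (intro exI conjI allI impI)
  define L where "L = root_list"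
  let ?Bs = "map (block_at n (set L)) L"
  have sub: "set L \<subseteq> {1..n}" and top: "top_root \<in> set L"
    using record_offsets_root_list(1) by (simp_all add: L_def)
  have dist: "distinct L" unfolding L_def by (rule distinct_root_list)
  have P: "the_circ_partition n \<delta> \<sigma> = blocks n (set L)"
    unfolding L_def by (rule the_circ_partition_eq)
  show "distinct ?Bs"
    using dist inj_on_block_at[OF n_pos sub] by (simp add: distinct_map)
  show "set ?Bs = the_circ_partition n \<delta> \<sigma>"
    by (simp add: P blocks_def)
  show "map (block_root n \<delta> \<sigma> (the_circ_partition n \<delta> \<sigma>)) ?Bs = root_list"
    unfolding P map_map L_def[symmetric]
    using block_root_block_at[OF sub] top by (intro map_idI) simp
  fix k assume "Suc k < length ?Bs"
  then have k: "Suc k < length L" by simp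
  then have card: "2 \<le> card (set L)" using distinct_card[OF dist] by simp
  have mem: "L ! k \<in> set L" "L ! Suc k \<in> set L"
    using k by (auto intro: nth_mem)
  have "arc_follows n (block_at n (set L) (L ! k)) (block_at n (set L) (L ! Suc k))"
    unfolding arc_follows_block_at[OF n_pos sub mem card]
    using root_list_gap[of k] k unfolding L_def[symmetric] by blast
  then show "arc_follows n (?Bs ! k) (?Bs ! Suc k)"
    using k by simp
qed

end


section \<open>Reflection\<close>

lemma both_signs_twice_reflect:
  assumes "both_signs_twice n \<eta>"
  shows "both_signs_twice n (reflect_sign n \<eta>)"
  unfolding both_signs_twice_iff
proof (intro allI)
  fix p s
  have n: "0 < n" using assms by (rule both_signs_twice_imp_pos)
  obtain i where i: "i \<in> {1..n}" "i \<noteq> cyc n (n - p)" "\<eta> i = - s"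
    using assms unfolding both_signs_twice_iff by blast
  have "cyc n (n - cyc n (n - i)) = i"
  proof (cases "i = n")
    case False
    with i(1) have "cyc n (n - i) = n - i" by (intro cyc_id) auto
    with i(1) show ?thesis by (simp add: cyc_id)
  qed (simp add: cyc_def)
  then have "reflect_sign n \<eta> (cyc n (n - i)) = s" "cyc n (n - i) \<noteq> p"
    using i(2,3) by (auto simp: reflect_sign_def)
  with cyc_in[OF n] show "\<exists>j\<in>{1..n}. j \<noteq> p \<and> reflect_sign n \<eta> j = s"
    by blast
qed

text \<open>The direction of the edge into \<open>y\<^sub>j\<close> is read off from \<open>\<eta>\<close> at the position reflected to \<open>j\<close>;
  the shift by one in the definition of \<open>\<delta>\<close> is made for this.\<close>

lemma reflect_sign_pred:
  assumes "i \<in> {1..n}"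
  shows "- reflect_sign n \<eta> (cyc_pred n (n + 1 - i)) = \<eta> i"
proof (cases "i = n")
  case True
  with assms have "cyc_pred n (n + 1 - i) = n" by (simp add: cyc_pred_def cyc_def)
  with True show ?thesis by (simp add: reflect_sign_def cyc_def)
next
  case False
  have "cyc_pred n (n + 1 - i) = cyc n ((n - i) + n)"
    using assms by (simp add: cyc_pred_def Suc_diff_le)
  also have "\<dots> = n - i"
    using assms False by (intro cyc_add_n_id) auto
  finally show ?thesis
    using assms by (simp add: reflect_sign_def cyc_id)
qed

lemma perm_rev_reflect: "i \<in> {1..n} \<Longrightarrow> perm_rev n \<pi> (n + 1 - i) = \<pi> i"
  by (auto simp: perm_rev_def)

lemma reflect_backward_scan:
  assumes "r \<in> {1..n}" "k < n"
  shows "n + 1 - cyc n (r + n - k) = cyc n (n + 1 - r + k)"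
proof (cases "r \<le> k")
  case True
  have "cyc n (r + n - k) = r + n - k"
    using assms True by (intro cyc_id) auto
  moreover have "cyc n ((k + 1 - r) + n) = k + 1 - r"
    using assms True by (intro cyc_add_n_id) auto
  moreover have "(k + 1 - r) + n = n + 1 - r + k" "n + 1 - (r + n - k) = k + 1 - r"
    using assms True by auto
  ultimately show ?thesis by metis
next
  case False
  have "cyc n ((r - k) + n) = r - k"
    using assms False by (intro cyc_add_n_id) auto
  moreover have "(r - k) + n = r + n - k" "n + 1 - (r - k) = n + 1 - r + k"
    using assms False by auto
  moreover have "cyc n (n + 1 - r + k) = n + 1 - r + k"
    using assms False by (intro cyc_id) auto
  ultimately show ?thesis by metis
qed

lemma labelled_cycle_reflect:
  assumes "both_signs_twice n \<eta>" "\<pi> permutes {1..n}"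
  shows "labelled_cycle n (reflect_sign n \<eta>) (perm_rev n \<pi>)"
proof
  show "both_signs_twice n (reflect_sign n \<eta>)"
    using assms(1) by (rule both_signs_twice_reflect)
  show "inj_on (perm_rev n \<pi>) {1..n}"
  proof (rule inj_onI)
    fix x y assume xy: "x \<in> {1..n}" "y \<in> {1..n}" "perm_rev n \<pi> x = perm_rev n \<pi> y"
    then have "\<pi> (n + 1 - x) = \<pi> (n + 1 - y)" by (simp add: perm_rev_def)
    then have "n + 1 - x = n + 1 - y"
      using permutes_inj[OF assms(2)] by (auto dest: injD)
    with xy show "x = y" by auto
  qed
qed

lemma reflect_cyc_records:
  assumes "both_signs_twice n \<eta>" "\<pi> permutes {1..n}"
  defines "\<delta> \<equiv> reflect_sign n \<eta>" and "\<sigma> \<equiv> perm_rev n \<pi>"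
  shows "n + 1 - canonical_record n \<eta> \<pi> = largest_ascent n \<delta> \<sigma>"
    and "map (\<lambda>i. n + 1 - i) (cyc_records n \<eta> \<pi>) =
      largest_ascent n \<delta> \<sigma> # scan_records (\<lambda>j. - \<delta> (cyc_pred n j)) \<sigma> (\<sigma> (largest_ascent n \<delta> \<sigma>))
        (map (\<lambda>t. cyc n (largest_ascent n \<delta> \<sigma> + t)) [1..<n])"
proof -
  interpret labelled_cycle n \<delta> \<sigma>
    unfolding \<delta>_def \<sigma>_def using assms(1,2) by (rule labelled_cycle_reflect)
  define r where "r = canonical_record n \<eta> \<pi>"
  have "finite (plus_positions n \<eta>)" by (simp add: plus_positions_def)
  moreover have "plus_positions n \<eta> \<noteq> {}"
    using assms(1) unfolding both_signs_twice_iff plus_positions_def by blast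
  ultimately obtain a where a: "a \<in> plus_positions n \<eta>" "\<And>x. x \<in> plus_positions n \<eta> \<Longrightarrow> \<pi> x \<le> \<pi> a"
    using argmax_exists[of "plus_positions n \<eta>" \<pi>] by blast
  have "inj_on \<pi> (plus_positions n \<eta>)"
    using permutes_inj[OF assms(2)] by (rule inj_on_subset) simp
  then have "r = a"
    using the_argmax[of "plus_positions n \<eta>" \<pi> a] a \<open>finite _\<close>
    unfolding r_def canonical_record_def by simp
  with a have r: "r \<in> {1..n}" "\<eta> r = SPlus" "\<And>x. x \<in> {1..n} \<Longrightarrow> \<eta> x = SPlus \<Longrightarrow> \<pi> x \<le> \<pi> r"
    by (auto simp: plus_positions_def)
  have dir: "direction (n + 1 - i) = \<eta> i" if "i \<in> {1..n}" for i
    unfolding \<delta>_def using that by (rule reflect_sign_pred)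
  have lab: "\<sigma> (n + 1 - i) = \<pi> i" if "i \<in> {1..n}" for i
    unfolding \<sigma>_def using that by (rule perm_rev_reflect)
  have top: "top_root = n + 1 - r"
  proof (rule largest_ascent_eqI)
    have "n + 1 - r \<in> {1..n}" using r(1) by auto
    with dir[OF r(1)] r(2) show "ascent_vertex n \<delta> (n + 1 - r)"
      unfolding ascent_iff by simp
    show "\<sigma> x \<le> \<sigma> (n + 1 - r)" if "ascent_vertex n \<delta> x" for x
    proof -
      have x: "x \<in> {1..n}" "direction x = SPlus" using that by (simp_all only: ascent_iff)
      then have "n + 1 - x \<in> {1..n}" "n + 1 - (n + 1 - x) = x" by auto
      with dir[of "n + 1 - x"] lab[of "n + 1 - x"] lab[OF r(1)] r(3)[of "n + 1 - x"] x(2)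
      show ?thesis by metis
    qed
  qed
  then show "n + 1 - canonical_record n \<eta> \<pi> = top_root" by (simp add: r_def)
  let ?ps = "map (\<lambda>k. cyc n (r + n - k)) [1..<n]"
  have ps: "i \<in> {1..n}" if "i \<in> set ?ps" for i
    using that cyc_in[OF n_pos] by auto
  have scan: "map (\<lambda>i. n + 1 - i) (scan_records \<eta> \<pi> (\<pi> r) ?ps) =
      scan_records direction \<sigma> (\<pi> r) (map (\<lambda>i. n + 1 - i) ?ps)"
    using dir[OF ps] lab[OF ps] by (rule scan_records_map)
  have positions: "map (\<lambda>i. n + 1 - i) ?ps = map from_top [1..<n]"
    unfolding top map_map
    by (rule map_cong[OF refl]) (use reflect_backward_scan[OF r(1)] in \<open>simp only: o_apply set_upt atLeastLessThan_iff\<close>)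
  have label: "\<pi> r = \<sigma> (n + 1 - r)"
    using lab[OF r(1)] by simp
  have "cyc_records n \<eta> \<pi> = r # scan_records \<eta> \<pi> (\<pi> r) ?ps"
    by (simp only: cyc_records_def Let_def r_def)
  then show "map (\<lambda>i. n + 1 - i) (cyc_records n \<eta> \<pi>) = root_list"
    by (simp only: list.map scan positions) (simp only: label top)
qed

theorem proposition4p5:
  fixes n :: nat and \<eta> :: "nat \<Rightarrow> sign"
  assumes "both_signs n \<eta>"
  shows "(both_signs_twice n \<eta> \<longleftrightarrow> is_cycle_graph {1..n} (hasse_edges (cyc_less n \<eta>))) \<and>
    (both_signs_twice n \<eta> \<longrightarrow>
      (\<forall>\<pi>. \<pi> permutes {1..n} \<longrightarrow>
        (let \<delta> = reflect_sign n \<eta>;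
             \<sigma> = perm_rev n \<pi>;
             rs = cyc_records n \<eta> \<pi>;
             r = canonical_record n \<eta> \<pi>;
             P = the_circ_partition n \<delta> \<sigma>
         in crec n \<eta> \<pi> = circ_bl n \<delta> \<sigma> \<and>
            (\<exists>!Q. valid_circ_partition n \<delta> \<sigma> Q) \<and>
            n + 1 - r \<in> block_root n \<delta> \<sigma> P ` P \<and>
            ascent_vertex n \<delta> (n + 1 - r) \<and>
            (\<forall>j. ascent_vertex n \<delta> j \<longrightarrow> \<sigma> j \<le> \<sigma> (n + 1 - r)) \<and>
            (\<exists>Bs. distinct Bs \<and> set Bs = P \<and>
               map (block_root n \<delta> \<sigma> P) Bs = map (\<lambda>i. n + 1 - i) rs \<and>
               (\<forall>k. Suc k < length Bs \<longrightarrow> arc_follows n (Bs ! k) (Bs ! Suc k))))))"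
proof (intro conjI impI allI)
  show "both_signs_twice n \<eta> \<longleftrightarrow> is_cycle_graph {1..n} (hasse_edges (cyc_less n \<eta>))"
    using assms by (rule both_signs_twice_iff_cycle)
next
  fix \<pi> assume tw: "both_signs_twice n \<eta>" and perm: "\<pi> permutes {1..n}"
  define \<delta> where "\<delta> = reflect_sign n \<eta>"
  define \<sigma> where "\<sigma> = perm_rev n \<pi>"
  define P where "P = the_circ_partition n \<delta> \<sigma>"
  define L where "L = map (\<lambda>i. n + 1 - i) (cyc_records n \<eta> \<pi>)"
  interpret labelled_cycle n \<delta> \<sigma>
    unfolding \<delta>_def \<sigma>_def using tw perm by (rule labelled_cycle_reflect)
  have top: "n + 1 - canonical_record n \<eta> \<pi> = top_root" and L: "L = root_list"
    unfolding \<delta>_def \<sigma>_def L_def by (fact reflect_cyc_records[OF tw perm])+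
  obtain Bs where Bs: "distinct Bs" "set Bs = P" "map (block_root n \<delta> \<sigma> P) Bs = L"
    "\<forall>k. Suc k < length Bs \<longrightarrow> arc_follows n (Bs ! k) (Bs ! Suc k)"
    using blocks_in_root_order unfolding P_def[symmetric] L[symmetric] by blast
  have "crec n \<eta> \<pi> = length L" by (simp add: crec_def L_def)
  also have "\<dots> = card P"
    unfolding Bs(2,3)[symmetric] using distinct_card[OF Bs(1)] by simp
  finally have "crec n \<eta> \<pi> = circ_bl n \<delta> \<sigma>" by (simp add: circ_bl_def P_def)
  moreover have "\<exists>!Q. valid_circ_partition n \<delta> \<sigma> Q"
    unfolding valid_iff_root_list by simp
  moreover have "top_root \<in> block_root n \<delta> \<sigma> P ` P"
  proof -
    have "top_root \<in> set L" unfolding L by simp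
    then show ?thesis unfolding Bs(3)[symmetric] set_map Bs(2) .
  qed
  ultimately show "let \<delta> = reflect_sign n \<eta>;
             \<sigma> = perm_rev n \<pi>;
             rs = cyc_records n \<eta> \<pi>;
             r = canonical_record n \<eta> \<pi>;
             P = the_circ_partition n \<delta> \<sigma>
         in crec n \<eta> \<pi> = circ_bl n \<delta> \<sigma> \<and>
            (\<exists>!Q. valid_circ_partition n \<delta> \<sigma> Q) \<and>
            n + 1 - r \<in> block_root n \<delta> \<sigma> P ` P \<and>
            ascent_vertex n \<delta> (n + 1 - r) \<and>
            (\<forall>j. ascent_vertex n \<delta> j \<longrightarrow> \<sigma> j \<le> \<sigma> (n + 1 - r)) \<and>
            (\<exists>Bs. distinct Bs \<and> set Bs = P \<and>
               map (block_root n \<delta> \<sigma> P) Bs = map (\<lambda>i. n + 1 - i) rs \<and>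
               (\<forall>k. Suc k < length Bs \<longrightarrow> arc_follows n (Bs ! k) (Bs ! Suc k)))"
    unfolding Let_def \<delta>_def[symmetric] \<sigma>_def[symmetric] P_def[symmetric] L_def[symmetric] top
    by (intro conjI allI impI exI[of _ Bs] top_root) (use Bs in simp_all)
qed

end
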